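(* Let $W$ be an abelian group, $G=\langle g_1,\dots,g_n\rangle$ a finite abelian group, and $\Upsilon:G\to\mathrm{Aut}(W)$ an action of $G$ on $W$. For $1\le i\le n$ let $q_i$ be the order of $g_i$ modulo $\langle g_1,\dots,g_{i-1}\rangle$, and let $t_j^{(i)}$ ($1\le j<i$) be the integers determined by $$g_i^{q_i}=g_1^{t_1^{(i)}}\cdots g_{i-1}^{t_{i-1}^{(i)}},\qquad 0\le t_j^{(i)}<q_j.$$ For $w\in W$, $1\le i\le n$ and $t\ge 0$ let $$\Upsilon_i=\Upsilon(g_i),\quad N_i^t(w)=w\,\Upsilon_i(w)\,\Upsilon_i^2(w)\cdots\Upsilon_i^{t-1}(w),\quad N_i=N_i^{q_i}.$$ For every $1\le i,j\le n$ let $\beta_{ij}$ and $\gamma_i$ be elements of $W$. Then the following conditions are equivalent: (1) There is a factor set $\alpha\in Z^2(G,W)$ inducing the data $(\beta_{ij},\gamma_i)$. (2) The following equalities hold for every $1\le i,j,k\le n$: (C1) $\beta_{ii}=\beta_{ij}\beta_{ji}=1$. (C2) $\beta_{ij}\beta_{jk}\beta_{ki}=\Upsilon_k(\beta_{ij})\Upsilon_i(\beta_{jk})\Upsilon_j(\beta_{ki})$. (C3) $N_i(\beta_{ij})\gamma_i=\Upsilon_j(\gamma_i)\, N_1^{t_1^{(i)}}(\beta_{1j})\,\Upsilon_1^{t_1^{(i)}}\big(N_2^{t_2^{(i)}}(\beta_{2j})\big)\cdots \Upsilon_1^{t_1^{(i)}}\Upsilon_2^{t_2^{(i)}}\cd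ots\Upsilon_{i-2}^{t_{i-2}^{(i)}}\big(N_{i-1}^{t_{i-1}^{(i)}}(\beta_{(i-1)j})\big)$.
   Context: A group epimorphism $\pi:\overline{G}\to G$ with kernel $W$ induces $\Upsilon$ if $u_gwu_g^{-1}=\Upsilon(g)(w)$ for each $w\in W$ whenever $u_g\in\overline{G}$ satisfies $\pi(u_g)=g$. A crossed section of $\pi$ is a map $g\mapsto u_g$ from $G$ to $\overline{G}$ with $\pi(u_g)=g$ for all $g\in G$; crossed sections are always assumed normalized, i.e. $u_1=1$. The factor set (2-cocycle) $\alpha\in Z^2(G,W)$ associated to $\pi$ and the crossed section $g\mapsto u_g$ is defined by $u_gu_h=\alpha_{g,h}u_{gh}$. A factor set $\alpha\in Z^2(G,W)$ induces the data $(\beta_{ij},\gamma_i)_{1\le i,j\le n}$ (relative to the list of generators $g_1,\dots,g_n$) if $\alpha$ is the factor set associated to some epimorphism $\pi:\overline{G}\to G$ with kernel $W$ inducing $\Upsilon$ and some (normalized) crossed section $g\mapsto u_g$ of $\pi$, and the values $u_{g_1},\dots,u_{g_n}$ of this same crossed section satisfy, for all $1\le i,j\le n$, $$u_{g_j}u_{g_i}=\beta_{ij}u_{g_i}u_{g_j},\qquad u_{g_i}^{q_i}=\gamma_i u_{g_1}^{t_1^{(i)}}\cdots u_{g_{i-1}}^{t_{i-1}^{(i)}}.$$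
   Formalization: The generators g_1,…,g_n are assumed pairwise distinct and different from 1; otherwise the claim fails, e.g. G=1, n=1, g_1=1, W=Z/2, β_11=1, γ_1≠1 satisfies (C1)–(C3), but the normalized section u_1=1 forces γ_1=1. *)

theory Defs
  imports "HOL-Algebra.Algebra"
begin

section \<open>Products and norms\<close>

text \<open>Product of a list in the order of the list; the group need not be commutative.\<close>

definition list_prod :: "('a, 'm) monoid_scheme \<Rightarrow> 'a list \<Rightarrow> 'a"
  where "list_prod G xs = foldr (\<otimes>\<^bsub>G\<^esub>) xs \<one>\<^bsub>G\<^esub>"

text \<open>\<open>norm_prod W \<sigma> t w\<close> is \<open>w \<sigma>(w) \<dots> \<sigma>\<^sup>t\<^sup>-\<^sup>1(w)\<close>, which is the
  element \<open>N\<^sub>i\<^sup>t(w)\<close> when \<open>\<sigma> = \<Upsilon>(g\<^sub>i)\<close>.\<close>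

definition norm_prod :: "('w, 'm) monoid_scheme \<Rightarrow> ('w \<Rightarrow> 'w) \<Rightarrow> nat \<Rightarrow> 'w \<Rightarrow> 'w"
  where "norm_prod W \<sigma> t w = finprod W (\<lambda>s. (\<sigma> ^^ s) w) {..<t}"

text \<open>The order of \<open>g\<^sub>i\<close> modulo \<open>\<langle>g\<^sub>1, \<dots>, g\<^sub>i\<^sub>-\<^sub>1\<rangle>\<close>; lists of generators are indexed from 1.\<close>

definition rel_order :: "('g, 'm) monoid_scheme \<Rightarrow> (nat \<Rightarrow> 'g) \<Rightarrow> nat \<Rightarrow> nat"
  where "rel_order G g i =
    (let H = generate G (g ` {1..<i}) in group.ord (G Mod H) (H #>\<^bsub>G\<^esub> g i))"


section \<open>Extensions, crossed sections and factor sets\<close>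

text \<open>An epimorphism \<open>\<pi> : E \<rightarrow> G\<close> with kernel \<open>W\<close>. The kernel is identified with \<open>W\<close> by
  the monomorphism \<open>\<iota>\<close>, which replaces the set-theoretic inclusion of \<open>W\<close> in \<open>E\<close>.\<close>

definition epi_with_kernel ::
  "('w, 'm) monoid_scheme \<Rightarrow> ('g, 'k) monoid_scheme \<Rightarrow> ('e, 'l) monoid_scheme
    \<Rightarrow> ('w \<Rightarrow> 'e) \<Rightarrow> ('e \<Rightarrow> 'g) \<Rightarrow> bool"
  where "epi_with_kernel W G E \<iota> \<pi> \<longleftrightarrow>
    group E \<and> \<pi> \<in> epi E G \<and> \<iota> \<in> mon W E \<and> \<iota> ` carrier W = kernel E G \<pi>"

definition induces_action ::
  "('w, 'm) monoid_scheme \<Rightarrow> ('g, 'k) monoid_scheme \<Rightarrow> ('g \<Rightarrow> 'w \<Rightarrow> 'w)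
    \<Rightarrow> ('e, 'l) monoid_scheme \<Rightarrow> ('w \<Rightarrow> 'e) \<Rightarrow> ('e \<Rightarrow> 'g) \<Rightarrow> bool"
  where "induces_action W G \<Upsilon> E \<iota> \<pi> \<longleftrightarrow>
    (\<forall>g \<in> carrier G. \<forall>x \<in> carrier E. \<forall>w \<in> carrier W.
      \<pi> x = g \<longrightarrow> x \<otimes>\<^bsub>E\<^esub> \<iota> w \<otimes>\<^bsub>E\<^esub> inv\<^bsub>E\<^esub> x = \<iota> (\<Upsilon> g w))"

definition crossed_section ::
  "('g, 'k) monoid_scheme \<Rightarrow> ('e, 'l) monoid_scheme \<Rightarrow> ('e \<Rightarrow> 'g) \<Rightarrow> ('g \<Rightarrow> 'e) \<Rightarrow> bool"
  where "crossed_section G E \<pi> u \<longleftrightarrow>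
    u \<in> carrier G \<rightarrow> carrier E \<and> (\<forall>g \<in> carrier G. \<pi> (u g) = g) \<and> u \<one>\<^bsub>G\<^esub> = \<one>\<^bsub>E\<^esub>"

definition factor_sets ::
  "('w, 'm) monoid_scheme \<Rightarrow> ('g, 'k) monoid_scheme \<Rightarrow> ('g \<Rightarrow> 'w \<Rightarrow> 'w) \<Rightarrow> ('g \<Rightarrow> 'g \<Rightarrow> 'w) set"
  where "factor_sets W G \<Upsilon> =
    {\<alpha>. \<alpha> \<in> carrier G \<rightarrow> carrier G \<rightarrow> carrier W \<and>
      (\<forall>x \<in> carrier G. \<forall>y \<in> carrier G. \<forall>z \<in> carrier G.
        \<alpha> x y \<otimes>\<^bsub>W\<^esub> \<alpha> (x \<otimes>\<^bsub>G\<^esub> y) z = \<Upsilon> x (\<alpha> y z) \<otimes>\<^bsub>W\<^esub> \<alpha> x (y \<otimes>\<^bsub>G\<^esub> z))}"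

definition associated_factor_set ::
  "('g, 'k) monoid_scheme \<Rightarrow> ('e, 'l) monoid_scheme \<Rightarrow> ('w \<Rightarrow> 'e) \<Rightarrow> ('g \<Rightarrow> 'e)
    \<Rightarrow> ('g \<Rightarrow> 'g \<Rightarrow> 'w) \<Rightarrow> bool"
  where "associated_factor_set G E \<iota> u \<alpha> \<longleftrightarrow>
    (\<forall>g \<in> carrier G. \<forall>h \<in> carrier G. u g \<otimes>\<^bsub>E\<^esub> u h = \<iota> (\<alpha> g h) \<otimes>\<^bsub>E\<^esub> u (g \<otimes>\<^bsub>G\<^esub> h))"


section \<open>Factor sets inducing given data\<close>

definition section_has_data ::
  "nat \<Rightarrow> (nat \<Rightarrow> 'g) \<Rightarrow> (nat \<Rightarrow> nat) \<Rightarrow> (nat \<Rightarrow> nat \<Rightarrow> nat) \<Rightarrow> (nat \<Rightarrow> nat \<Rightarrow> 'w) \<Rightarrow> (nat \<Rightarrow> 'w)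
    \<Rightarrow> ('e, 'l) monoid_scheme \<Rightarrow> ('w \<Rightarrow> 'e) \<Rightarrow> ('g \<Rightarrow> 'e) \<Rightarrow> bool"
  where "section_has_data n g q t \<beta> \<gamma> E \<iota> u \<longleftrightarrow>
    (\<forall>i \<in> {1..n}. \<forall>j \<in> {1..n}.
      u (g j) \<otimes>\<^bsub>E\<^esub> u (g i) = \<iota> (\<beta> i j) \<otimes>\<^bsub>E\<^esub> u (g i) \<otimes>\<^bsub>E\<^esub> u (g j)) \<and>
    (\<forall>i \<in> {1..n}.
      u (g i) [^]\<^bsub>E\<^esub> q i =
        \<iota> (\<gamma> i) \<otimes>\<^bsub>E\<^esub> list_prod E (map (\<lambda>j. u (g j) [^]\<^bsub>E\<^esub> t i j) [1..<i]))"

definition induces_data_via ::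
  "('w, 'm) monoid_scheme \<Rightarrow> ('g, 'k) monoid_scheme \<Rightarrow> ('g \<Rightarrow> 'w \<Rightarrow> 'w)
    \<Rightarrow> nat \<Rightarrow> (nat \<Rightarrow> 'g) \<Rightarrow> (nat \<Rightarrow> nat) \<Rightarrow> (nat \<Rightarrow> nat \<Rightarrow> nat) \<Rightarrow> (nat \<Rightarrow> nat \<Rightarrow> 'w) \<Rightarrow> (nat \<Rightarrow> 'w)
    \<Rightarrow> ('g \<Rightarrow> 'g \<Rightarrow> 'w) \<Rightarrow> ('e, 'l) monoid_scheme \<Rightarrow> ('w \<Rightarrow> 'e) \<Rightarrow> ('e \<Rightarrow> 'g) \<Rightarrow> ('g \<Rightarrow> 'e) \<Rightarrow> bool"
  where "induces_data_via W G \<Upsilon> n g q t \<beta> \<gamma> \<alpha> E \<iota> \<pi> u \<longleftrightarrow>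
    epi_with_kernel W G E \<iota> \<pi> \<and> induces_action W G \<Upsilon> E \<iota> \<pi> \<and> crossed_section G E \<pi> u \<and>
    associated_factor_set G E \<iota> u \<alpha> \<and> section_has_data n g q t \<beta> \<gamma> E \<iota> u"

text \<open>HOL cannot quantify over the type of the elements of the extension group. The type
  \<^typ>\<open>'w \<times> 'g\<close> is large enough for every extension of \<open>G\<close> by \<open>W\<close>, so fixing it loses
  nothing: this is the lemma \<open>induces_data_any_type\<close> below.\<close>

definition induces_data ::
  "('w, 'm) monoid_scheme \<Rightarrow> ('g, 'k) monoid_scheme \<Rightarrow> ('g \<Rightarrow> 'w \<Rightarrow> 'w)
    \<Rightarrow> nat \<Rightarrow> (nat \<Rightarrow> 'g) \<Rightarrow> (nat \<Rightarrow> nat) \<Rightarrow> (nat \<Rightarrow> nat \<Rightarrow> nat) \<Rightarrow> (nat \<Rightarrow> nat \<Rightarrow> 'w) \<Rightarrow> (nat \<Rightarrow> 'w)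
    \<Rightarrow> ('g \<Rightarrow> 'g \<Rightarrow> 'w) \<Rightarrow> bool"
  where "induces_data W G \<Upsilon> n g q t \<beta> \<gamma> \<alpha> \<longleftrightarrow>
    (\<exists>(E :: ('w \<times> 'g) monoid) \<iota> \<pi> u. induces_data_via W G \<Upsilon> n g q t \<beta> \<gamma> \<alpha> E \<iota> \<pi> u)"

lemma list_prod_closed:
  assumes "monoid E" "set xs \<subseteq> carrier E"
  shows "list_prod E xs \<in> carrier E"
  using assms(2) by (induction xs) (auto simp: list_prod_def monoid.m_closed[OF assms(1)] monoid.one_closed[OF assms(1)])

lemma hom_list_prod:
  assumes "group E" "group F" "\<phi> \<in> hom E F" "set xs \<subseteq> carrier E"
  shows "\<phi> (list_prod E xs) = list_prod F (map \<phi> xs)"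
  using assms(4)
proof (induction xs)
  case Nil
  then show ?case using hom_one[OF assms(3,1,2)] by (simp add: list_prod_def)
next
  case (Cons x xs)
  have "list_prod E xs \<in> carrier E"
    using Cons.prems by (intro list_prod_closed group.is_monoid assms(1)) auto
  then show ?case
    using Cons hom_mult[OF assms(3), of x "list_prod E xs"] by (simp add: list_prod_def)
qed

lemma induces_data_any_type:
  fixes W :: "('w, 'm) monoid_scheme" and G :: "('g, 'k) monoid_scheme"
    and E :: "('e, 'l) monoid_scheme"
  assumes W: "group W" and G: "group G"
    and \<alpha>: "\<alpha> \<in> carrier G \<rightarrow> carrier G \<rightarrow> carrier W"
    and g: "g \<in> {1..n} \<rightarrow> carrier G"
    and \<beta>: "\<beta> \<in> {1..n} \<rightarrow> {1..n} \<rightarrow> carrier W" and \<gamma>: "\<gamma> \<in> {1..n} \<rightarrow> carrier W"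
    and via: "induces_data_via W G \<Upsilon> n g q t \<beta> \<gamma> \<alpha> E \<iota> \<pi> u"
  shows "induces_data W G \<Upsilon> n g q t \<beta> \<gamma> \<alpha>"
proof -
  interpret W: group W by fact
  interpret G: group G by fact
  from via have ext: "epi_with_kernel W G E \<iota> \<pi>" and act: "induces_action W G \<Upsilon> E \<iota> \<pi>"
    and sec: "crossed_section G E \<pi> u" and fs: "associated_factor_set G E \<iota> u \<alpha>"
    and dat: "section_has_data n g q t \<beta> \<gamma> E \<iota> u"
    by (auto simp: induces_data_via_def)
  from ext interpret E: group E by (simp add: epi_with_kernel_def)
  from ext have pi: "\<pi> \<in> hom E G" "\<pi> ` carrier E = carrier G"
    and io: "\<iota> \<in> hom W E" "inj_on \<iota> (carrier W)" and ker: "\<iota> ` carrier W = kernel E G \<pi>"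
    by (auto simp: epi_with_kernel_def epi_def mon_def)
  interpret pi: group_hom E G \<pi>
    by (intro group_hom.intro group_hom_axioms.intro pi(1) E.is_group G.is_group)
  from sec have u: "\<And>x. x \<in> carrier G \<Longrightarrow> u x \<in> carrier E"
    and pu: "\<And>x. x \<in> carrier G \<Longrightarrow> \<pi> (u x) = x" and u1: "u \<one>\<^bsub>G\<^esub> = \<one>\<^bsub>E\<^esub>"
    by (auto simp: crossed_section_def)
  have ioc: "\<And>w. w \<in> carrier W \<Longrightarrow> \<iota> w \<in> carrier E" using io(1) by (auto simp: hom_def)
  define \<phi> where "\<phi> x = (inv_into (carrier W) \<iota> (x \<otimes>\<^bsub>E\<^esub> inv\<^bsub>E\<^esub> u (\<pi> x)), \<pi> x)" for x
  have inW: "x \<otimes>\<^bsub>E\<^esub> inv\<^bsub>E\<^esub> u (\<pi> x) \<in> \<iota> ` carrier W" if "x \<in> carrier E" for x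
    using that by (simp add: ker kernel_def u pu)
  have inj: "inj_on \<phi> (carrier E)"
  proof (rule inj_onI)
    fix x y assume xy: "x \<in> carrier E" "y \<in> carrier E" "\<phi> x = \<phi> y"
    then have p: "\<pi> x = \<pi> y" by (simp add: \<phi>_def)
    have "x \<otimes>\<^bsub>E\<^esub> inv\<^bsub>E\<^esub> u (\<pi> x) = y \<otimes>\<^bsub>E\<^esub> inv\<^bsub>E\<^esub> u (\<pi> y)"
      using xy inW[OF xy(1)] inW[OF xy(2)] by (simp add: \<phi>_def) (metis f_inv_into_f)
    then show "x = y" using xy p u by simp
  qed
  define F where "F = image_group \<phi> E"
  have iso: "\<phi> \<in> iso E F"
    using inj unfolding F_def image_group_def iso_def hom_def
    by (auto simp: bij_betw_def)
  have grpF: "group F"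
    using E.iso_imp_img_group[OF iso] by (simp add: F_def image_group_def)
  have hom: "\<phi> \<in> hom E F" using iso by (simp add: iso_def)
  interpret phi: group_hom E F \<phi>
    by (intro group_hom.intro group_hom_axioms.intro hom E.is_group grpF)
  have carF: "carrier F = \<phi> ` carrier E" unfolding F_def by (rule image_group_carrier)
  define \<psi> where "\<psi> = inv_into (carrier E) \<phi>"
  have psi: "\<psi> (\<phi> x) = x" if "x \<in> carrier E" for x
    using that inj by (simp add: \<psi>_def)
  define \<pi>' where "\<pi>' = (\<lambda>y. \<pi> (\<psi> y))"
  define \<iota>' where "\<iota>' = (\<lambda>w. \<phi> (\<iota> w))"
  define u' where "u' = (\<lambda>x. \<phi> (u x))"
  have "epi_with_kernel W G F \<iota>' \<pi>'"
    unfolding epi_with_kernel_def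
  proof (intro conjI)
    have "\<pi>' \<in> hom F G"
    proof (rule homI)
      fix a b assume "a \<in> carrier F" "b \<in> carrier F"
      then obtain x y where xy: "x \<in> carrier E" "a = \<phi> x" "y \<in> carrier E" "b = \<phi> y"
        unfolding carF by blast
      then show "\<pi>' a \<in> carrier G" by (simp add: \<pi>'_def psi)
      have "a \<otimes>\<^bsub>F\<^esub> b = \<phi> (x \<otimes>\<^bsub>E\<^esub> y)" using xy by simp
      then show "\<pi>' (a \<otimes>\<^bsub>F\<^esub> b) = \<pi>' a \<otimes>\<^bsub>G\<^esub> \<pi>' b"
        using xy by (simp only: \<pi>'_def psi E.m_closed pi.hom_mult)
    qed
    moreover have "\<pi>' ` carrier F = carrier G"
      unfolding carF image_image pi(2)[symmetric] \<pi>'_def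
      by (rule image_cong) (simp_all add: psi)
    ultimately show "\<pi>' \<in> epi F G" by (simp add: epi_def)
    show "\<iota>' \<in> mon W F"
      unfolding mon_def \<iota>'_def using io inj ioc
      by (auto simp: hom_def inj_on_def)
    have "kernel F G \<pi>' = \<phi> ` kernel E G \<pi>"
      by (auto simp: kernel_def carF \<pi>'_def psi)
    then show "\<iota>' ` carrier W = kernel F G \<pi>'"
      by (simp add: \<iota>'_def ker[symmetric] image_image)
  qed (rule grpF)
  moreover have "induces_action W G \<Upsilon> F \<iota>' \<pi>'"
    unfolding induces_action_def
  proof (intro ballI impI)
    fix h y w assume h: "h \<in> carrier G" and y: "y \<in> carrier F" and w: "w \<in> carrier W"
      and e: "\<pi>' y = h"
    from y obtain x where x: "x \<in> carrier E" "y = \<phi> x" by (auto simp: carF)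
    have "x \<otimes>\<^bsub>E\<^esub> \<iota> w \<otimes>\<^bsub>E\<^esub> inv\<^bsub>E\<^esub> x = \<iota> (\<Upsilon> h w)"
      using act h w x e by (auto simp: induces_action_def \<pi>'_def psi)
    then have "\<phi> (x \<otimes>\<^bsub>E\<^esub> \<iota> w \<otimes>\<^bsub>E\<^esub> inv\<^bsub>E\<^esub> x) = \<phi> (\<iota> (\<Upsilon> h w))" by simp
    then show "y \<otimes>\<^bsub>F\<^esub> \<iota>' w \<otimes>\<^bsub>F\<^esub> inv\<^bsub>F\<^esub> y = \<iota>' (\<Upsilon> h w)"
      using x w by (simp add: \<iota>'_def ioc)
  qed
  moreover have "crossed_section G F \<pi>' u'"
    using u pu u1 by (auto simp: crossed_section_def u'_def \<pi>'_def psi)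
  moreover have "associated_factor_set G F \<iota>' u' \<alpha>"
    unfolding associated_factor_set_def
  proof (intro ballI)
    fix x y assume xy: "x \<in> carrier G" "y \<in> carrier G"
    then have "\<phi> (u x \<otimes>\<^bsub>E\<^esub> u y) = \<phi> (\<iota> (\<alpha> x y) \<otimes>\<^bsub>E\<^esub> u (x \<otimes>\<^bsub>G\<^esub> y))"
      using fs by (simp add: associated_factor_set_def)
    moreover have "\<alpha> x y \<in> carrier W" using xy \<alpha> by blast
    ultimately show "u' x \<otimes>\<^bsub>F\<^esub> u' y = \<iota>' (\<alpha> x y) \<otimes>\<^bsub>F\<^esub> u' (x \<otimes>\<^bsub>G\<^esub> y)"
      using xy by (simp add: u'_def \<iota>'_def u ioc)
  qed
  moreover have "section_has_data n g q t \<beta> \<gamma> F \<iota>' u'"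
    unfolding section_has_data_def
  proof (intro conjI ballI)
    fix i j assume ij: "i \<in> {1..n}" "j \<in> {1..n}"
    then have "\<phi> (u (g j) \<otimes>\<^bsub>E\<^esub> u (g i)) = \<phi> (\<iota> (\<beta> i j) \<otimes>\<^bsub>E\<^esub> u (g i) \<otimes>\<^bsub>E\<^esub> u (g j))"
      using dat by (simp add: section_has_data_def)
    moreover have "\<beta> i j \<in> carrier W" "g i \<in> carrier G" "g j \<in> carrier G"
      using ij \<beta> g by blast+
    ultimately show "u' (g j) \<otimes>\<^bsub>F\<^esub> u' (g i) = \<iota>' (\<beta> i j) \<otimes>\<^bsub>F\<^esub> u' (g i) \<otimes>\<^bsub>F\<^esub> u' (g j)"
      by (simp add: u'_def \<iota>'_def u ioc)
  next
    fix i assume i: "i \<in> {1..n}"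
    let ?xs = "map (\<lambda>j. u (g j) [^]\<^bsub>E\<^esub> t i j) [1..<i]"
    have gc: "g j \<in> carrier G" if "j \<in> {1..n}" for j using g that by blast
    have xs: "set ?xs \<subseteq> carrier E"
      using i by (auto intro!: E.nat_pow_closed u gc)
    have "map \<phi> ?xs = map (\<lambda>j. u' (g j) [^]\<^bsub>F\<^esub> t i j) [1..<i]"
      using i by (auto simp: u'_def phi.hom_nat_pow u gc)
    then have lp: "\<phi> (list_prod E ?xs) = list_prod F (map (\<lambda>j. u' (g j) [^]\<^bsub>F\<^esub> t i j) [1..<i])"
      using hom_list_prod[OF E.is_group grpF hom xs] by argo
    have "\<phi> (u (g i) [^]\<^bsub>E\<^esub> q i) = \<phi> (\<iota> (\<gamma> i) \<otimes>\<^bsub>E\<^esub> list_prod E ?xs)"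
      using dat i by (simp add: section_has_data_def)
    moreover have "\<gamma> i \<in> carrier W" using i \<gamma> by blast
    ultimately show "u' (g i) [^]\<^bsub>F\<^esub> q i =
        \<iota>' (\<gamma> i) \<otimes>\<^bsub>F\<^esub> list_prod F (map (\<lambda>j. u' (g j) [^]\<^bsub>F\<^esub> t i j) [1..<i])"
      using gc[OF i] list_prod_closed[OF E.is_monoid xs] lp
      by (simp add: u'_def \<iota>'_def u ioc phi.hom_nat_pow)
  qed
  ultimately have "induces_data_via W G \<Upsilon> n g q t \<beta> \<gamma> \<alpha> F \<iota>' \<pi>' u'"
    by (simp add: induces_data_via_def)
  then show ?thesis by (auto simp: induces_data_def)
qed

end

theory Submission
  imports Defs
begin

text \<open>Given an extension and lifts \<open>x\<^sub>i\<close> of the generators, C1 and C2 come from reordering products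
  of two and three lifts, and C3 from conjugating the power relation of \<open>x\<^sub>i\<close> by \<open>x\<^sub>j\<close>.

  Conversely, the extension is built by adjoining one lift at a time. If \<open>E\<close> extends
  \<open>\<langle>g\<^sub>1, \<dots>, g\<^sub>m\<rangle>\<close> by \<open>W\<close>, then the endomorphisms \<open>\<tau>\<^sub>j\<close> of \<open>E\<close> which act on \<open>W\<close> as \<open>g\<^sub>j\<close> and send
  \<open>x\<^sub>k\<close> to \<open>\<beta>\<^sub>k\<^sub>j x\<^sub>k\<close> are carried along for all \<open>j \<le> n\<close>. With \<open>i = m + 1\<close> and
  \<open>c\<close> the value prescribed for \<open>x\<^sub>i\<close> to the power \<open>q\<^sub>i\<close>, condition C3 says that \<open>\<tau>\<^sub>i c = c\<close> and that
  \<open>\<tau>\<^sub>i\<close> to the power \<open>q\<^sub>i\<close> is conjugation by \<open>c\<close>, so \<open>E\<close> has a cyclic extension by an element \<open>y\<close>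
  that acts on \<open>E\<close> as \<open>\<tau>\<^sub>i\<close> and whose power with exponent \<open>q\<^sub>i\<close> is \<open>c\<close>. Condition C2 says that \<open>\<tau>\<^sub>i\<close> and
  \<open>\<tau>\<^sub>j\<close> commute up to conjugation by \<open>\<beta>\<^sub>i\<^sub>j\<close>, which together with C3 lets every \<open>\<tau>\<^sub>j\<close> extend by
  \<open>y \<mapsto> \<beta>\<^sub>i\<^sub>j y\<close>.\<close>

section \<open>Ordered products, homomorphisms on generators, and orders modulo a subgroup\<close>

lemma list_prod_append:
  assumes "monoid E" "set xs \<subseteq> carrier E" "set ys \<subseteq> carrier E"
  shows "list_prod E (xs @ ys) = list_prod E xs \<otimes>\<^bsub>E\<^esub> list_prod E ys"
  using assms(2)
proof (induction xs)
  case Nil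
  then show ?case
    using list_prod_closed[OF assms(1,3)] by (simp add: list_prod_def monoid.l_one[OF assms(1)])
next
  case (Cons z zs)
  then show ?case
    using list_prod_closed[OF assms(1,3)] list_prod_closed[OF assms(1), of zs]
    by (simp add: list_prod_def monoid.m_assoc[OF assms(1)])
qed

text \<open>Words in the extension are ordered products, while the relations of \<open>G\<close> are
  stated with \<open>finprod\<close>; this lets the projection of a word be compared with such a
  relation.\<close>

lemma list_prod_eq_finprod:
  assumes "comm_group G" "\<And>k. k \<in> {1..<i::nat} \<Longrightarrow> f k \<in> carrier G"
  shows "list_prod G (map f [1..<i]) = finprod G f {1..<i}"
proof -
  interpret G: comm_group G by fact
  show ?thesis
    using assms(2)
  proof (induction i)
    case 0
    then show ?case by (simp add: list_prod_def)
  next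
    case (Suc i)
    show ?case
    proof (cases "i = 0")
      case True
      then show ?thesis by (simp add: list_prod_def)
    next
      case False
      then have *: "[1..<Suc i] = [1..<i] @ [i]" "{1..<Suc i} = insert i {1..<i}" by auto
      have fc: "f k \<in> carrier G" if "k \<in> {1..<i}" for k using Suc.prems that by simp
      have fi: "f i \<in> carrier G" using Suc.prems False by simp
      have sub: "f ` {1..<i} \<subseteq> carrier G" using fc by auto
      have "list_prod G (map f [1..<Suc i]) = finprod G f {1..<i} \<otimes>\<^bsub>G\<^esub> f i"
        unfolding * map_append
        using Suc.IH[OF fc] sub fi
        by (subst list_prod_append[OF G.is_monoid]) (auto simp: list_prod_def)
      also have "\<dots> = finprod G f {1..<Suc i}"
        unfolding * using fi fc by (simp add: G.finprod_insert Pi_def G.m_comm G.finprod_closed)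
      finally show ?thesis .
    qed
  qed
qed

lemma (in group_hom) hom_eq_on_generate:
  assumes "k \<in> hom G H" "S \<subseteq> carrier G" "\<And>s. s \<in> S \<Longrightarrow> h s = k s" "e \<in> generate G S"
  shows "h e = k e"
proof -
  interpret k: group_hom G H k
    by (intro group_hom.intro group_hom_axioms.intro assms(1)) simp_all
  have *: "e \<in> carrier G" if "e \<in> generate G S" for e
    using that G.generate_in_carrier[OF assms(2)] by blast
  from assms(4) show ?thesis
    by induction (use assms(2,3) * in \<open>auto simp: subset_iff\<close>)
qed

lemma (in group) conj_hom:
  assumes "a \<in> carrier G"
  shows "(\<lambda>e. a \<otimes> e \<otimes> inv a) \<in> hom G G"
  using assms by (intro homI) (simp_all add: m_assoc inv_solve_left)

text \<open>Powers of a coset are cosets of powers, and a coset is trivial exactly when its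
  representative lies in the subgroup. Afterwards only exponents occur, no cosets.\<close>

lemma (in comm_group) rel_order_dvd_iff:
  assumes "g ` {1..<i} \<subseteq> carrier G" "g i \<in> carrier G"
  shows "rel_order G g i dvd a \<longleftrightarrow> g i [^] a \<in> generate G (g ` {1..<i})"
proof -
  let ?H = "generate G (g ` {1..<i})"
  have sub: "subgroup ?H G" by (rule generate_is_subgroup[OF assms(1)])
  then interpret normal ?H G by (rule subgroup_imp_normal)
  interpret Q: group "G Mod ?H" by (rule factorgroup_is_group)
  have "?H #> g i \<in> carrier (G Mod ?H)" using assms(2) by (simp add: carrier_FactGroup)
  then have "rel_order G g i dvd a \<longleftrightarrow> (?H #> g i) [^]\<^bsub>G Mod ?H\<^esub> a = \<one>\<^bsub>G Mod ?H\<^esub>"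
    unfolding rel_order_def Let_def by (rule Q.pow_eq_id[symmetric])
  also have "\<dots> \<longleftrightarrow> ?H #> (g i [^] a) = ?H"
    by (simp only: FactGroup_pow[OF assms(2)] one_FactGroup)
  also have "\<dots> \<longleftrightarrow> g i [^] a \<in> ?H"
    using coset_join1[OF _ _ sub] coset_join2[OF _ sub] assms(2) by (metis nat_pow_closed)
  finally show ?thesis .
qed

text \<open>The exponent \<open>order G\<close> kills \<open>g i\<close>, so the relative order
  divides a positive number.\<close>

lemma (in comm_group) rel_order_pos:
  assumes "finite (carrier G)" "g ` {1..<i} \<subseteq> carrier G" "g i \<in> carrier G"
  shows "0 < rel_order G g i"
proof -
  have "rel_order G g i dvd order G"
    using assms rel_order_dvd_iff by (simp add: pow_order_eq_1 generate.one)
  then show ?thesis using assms(1) order_gt_0_iff_finite by (auto intro: Nat.gr0I)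
qed

text \<open>Clearing denominators. C2 takes this shape once some values of \<open>\<beta>\<close>
  are written as inverses by C1; it is applied both where C2 is derived and where it is
  used.\<close>

lemma (in comm_group) cross_mult:
  assumes "a \<otimes> inv u \<otimes> b = c \<otimes> inv v \<otimes> d"
    and [simp]: "a \<in> carrier G" "b \<in> carrier G" "c \<in> carrier G" "d \<in> carrier G"
      "u \<in> carrier G" "v \<in> carrier G"
  shows "v \<otimes> (a \<otimes> b) = u \<otimes> (c \<otimes> d)"
proof -
  have "v \<otimes> (a \<otimes> b) = (u \<otimes> inv u) \<otimes> (v \<otimes> (a \<otimes> b))" by simp
  also have "\<dots> = (u \<otimes> v) \<otimes> (a \<otimes> inv u \<otimes> b)"
    by (simp only: m_ac m_closed inv_closed assms(2-))
  also have "\<dots> = (v \<otimes> inv v) \<otimes> (u \<otimes> (c \<otimes> d))"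
    unfolding assms(1) by (simp only: m_ac m_closed inv_closed assms(2-))
  also have "\<dots> = u \<otimes> (c \<otimes> d)" by simp
  finally show ?thesis .
qed

section \<open>Cyclic extensions\<close>

text \<open>\<open>\<kappa>\<close> stands for the inclusion of \<open>N\<close>, whose image is
  normal with cyclic quotient of order \<open>q\<close> generated by the class of \<open>y\<close>.
  Unique normal forms make \<open>E\<close> the group given by \<open>N\<close> and the two
  relations for \<open>y\<close>.\<close>

locale cyclic_extension = N: group N + E: group E
  for N :: "('a, 'm) monoid_scheme" and E :: "('e, 'l) monoid_scheme" +
  fixes \<sigma> :: "'a \<Rightarrow> 'a" and c :: 'a and q :: nat and \<kappa> :: "'a \<Rightarrow> 'e" and y :: 'e
  assumes q_pos: "0 < q" and sigma_hom: "\<sigma> \<in> hom N N" and c_closed [simp]: "c \<in> carrier N"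
    and kappa_hom: "\<kappa> \<in> hom N E" and y_closed [simp]: "y \<in> carrier E"
    and y_pow: "y [^]\<^bsub>E\<^esub> q = \<kappa> c"
    and y_swap: "\<And>e. e \<in> carrier N \<Longrightarrow> y \<otimes>\<^bsub>E\<^esub> \<kappa> e = \<kappa> (\<sigma> e) \<otimes>\<^bsub>E\<^esub> y"
    and normal_form: "\<And>p. p \<in> carrier E \<Longrightarrow> \<exists>e\<in>carrier N. \<exists>a<q. p = \<kappa> e \<otimes>\<^bsub>E\<^esub> y [^]\<^bsub>E\<^esub> a"
    and normal_form_unique: "\<And>e f a b. e \<in> carrier N \<Longrightarrow> f \<in> carrier N \<Longrightarrow> a < q \<Longrightarrow> b < q \<Longrightarrow>
      \<kappa> e \<otimes>\<^bsub>E\<^esub> y [^]\<^bsub>E\<^esub> a = \<kappa> f \<otimes>\<^bsub>E\<^esub> y [^]\<^bsub>E\<^esub> b \<Longrightarrow> e = f \<and> a = b"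
begin

sublocale sigma: group_hom N N \<sigma>
  by (intro group_hom.intro group_hom_axioms.intro sigma_hom N.is_group)

sublocale kappa: group_hom N E \<kappa>
  by (intro group_hom.intro group_hom_axioms.intro kappa_hom N.is_group E.is_group)

lemma kappa_inj: "inj_on \<kappa> (carrier N)"
  using normal_form_unique[of _ _ 0 0] q_pos by (auto simp: inj_on_def)

lemma sigma_funpow_closed [simp]: "e \<in> carrier N \<Longrightarrow> (\<sigma> ^^ a) e \<in> carrier N"
  by (induction a) simp_all

lemma y_pow_swap:
  assumes "e \<in> carrier N"
  shows "y [^]\<^bsub>E\<^esub> a \<otimes>\<^bsub>E\<^esub> \<kappa> e = \<kappa> ((\<sigma> ^^ a) e) \<otimes>\<^bsub>E\<^esub> y [^]\<^bsub>E\<^esub> (a::nat)"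
proof (induction a)
  case (Suc a)
  have "y [^]\<^bsub>E\<^esub> Suc a \<otimes>\<^bsub>E\<^esub> \<kappa> e = y \<otimes>\<^bsub>E\<^esub> (y [^]\<^bsub>E\<^esub> a \<otimes>\<^bsub>E\<^esub> \<kappa> e)"
    using assms by (simp only: E.nat_pow_Suc2 y_closed E.m_assoc E.nat_pow_closed kappa.hom_closed)
  also have "\<dots> = (y \<otimes>\<^bsub>E\<^esub> \<kappa> ((\<sigma> ^^ a) e)) \<otimes>\<^bsub>E\<^esub> y [^]\<^bsub>E\<^esub> a"
    using assms Suc by (simp add: E.m_assoc)
  also have "\<dots> = \<kappa> ((\<sigma> ^^ Suc a) e) \<otimes>\<^bsub>E\<^esub> (y \<otimes>\<^bsub>E\<^esub> y [^]\<^bsub>E\<^esub> a)"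
    using assms by (simp add: y_swap E.m_assoc)
  finally show ?case by (simp only: E.nat_pow_Suc2 y_closed)
qed (use assms in simp)

text \<open>The universal property of \<open>E\<close>: the swap rule and the value of the
  \<open>q\<close>-th power alone reduce a product of normal forms to a normal form, so they are
  defining relations over \<open>N\<close>. It provides the projection and the endomorphisms of each
  new stage.\<close>

lemma extend_hom:
  assumes "group F" "\<phi> \<in> hom N F" "z \<in> carrier F"
    and z_swap: "\<And>e. e \<in> carrier N \<Longrightarrow> z \<otimes>\<^bsub>F\<^esub> \<phi> e = \<phi> (\<sigma> e) \<otimes>\<^bsub>F\<^esub> z"
    and z_pow: "z [^]\<^bsub>F\<^esub> q = \<phi> c"
  shows "\<exists>\<psi>\<in>hom E F. (\<forall>e\<in>carrier N. \<psi> (\<kappa> e) = \<phi> e) \<and> \<psi> y = z"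
proof -
  interpret F: group F by fact
  interpret phi: group_hom N F \<phi>
    by (intro group_hom.intro group_hom_axioms.intro assms N.is_group)
  \<comment> \<open>Read off the normal form of \<open>p\<close> and put \<open>z\<close> in place
    of \<open>y\<close>; uniqueness determines the chosen pair.\<close>
  define \<psi> where "\<psi> p = (let (e, a) = (SOME (e, a). e \<in> carrier N \<and> a < q \<and> p = \<kappa> e \<otimes>\<^bsub>E\<^esub> y [^]\<^bsub>E\<^esub> a)
    in \<phi> e \<otimes>\<^bsub>F\<^esub> z [^]\<^bsub>F\<^esub> a)" for p
  have small: "\<psi> (\<kappa> e \<otimes>\<^bsub>E\<^esub> y [^]\<^bsub>E\<^esub> a) = \<phi> e \<otimes>\<^bsub>F\<^esub> z [^]\<^bsub>F\<^esub> a" if "e \<in> carrier N" "a < q" for e and a :: nat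
  proof -
    have "(SOME (e', a'). e' \<in> carrier N \<and> a' < q \<and> \<kappa> e \<otimes>\<^bsub>E\<^esub> y [^]\<^bsub>E\<^esub> a = \<kappa> e' \<otimes>\<^bsub>E\<^esub> y [^]\<^bsub>E\<^esub> a') = (e, a)"
      using that normal_form_unique by (intro some_equality) auto
    then show ?thesis by (simp add: \<psi>_def)
  qed
  \<comment> \<open>The bound on the exponent is removed by turning each full \<open>q\<close>-th
    power into \<open>c\<close>, on both sides. Products then need no reduction of
    \<open>a + b\<close>.\<close>
  have psi: "\<psi> (\<kappa> e \<otimes>\<^bsub>E\<^esub> y [^]\<^bsub>E\<^esub> a) = \<phi> e \<otimes>\<^bsub>F\<^esub> z [^]\<^bsub>F\<^esub> a" if "e \<in> carrier N" for e and a :: nat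
  proof -
    have a: "a = q * (a div q) + a mod q" by simp
    have "y [^]\<^bsub>E\<^esub> a = \<kappa> (c [^]\<^bsub>N\<^esub> (a div q)) \<otimes>\<^bsub>E\<^esub> y [^]\<^bsub>E\<^esub> (a mod q)"
      by (subst a) (simp only: E.nat_pow_mult[symmetric] E.nat_pow_pow[symmetric] y_closed
          y_pow kappa.hom_nat_pow c_closed)
    then have "\<psi> (\<kappa> e \<otimes>\<^bsub>E\<^esub> y [^]\<^bsub>E\<^esub> a) = \<psi> (\<kappa> (e \<otimes>\<^bsub>N\<^esub> c [^]\<^bsub>N\<^esub> (a div q)) \<otimes>\<^bsub>E\<^esub> y [^]\<^bsub>E\<^esub> (a mod q))"
      using that by (simp add: E.m_assoc)
    also have "\<dots> = \<phi> (e \<otimes>\<^bsub>N\<^esub> c [^]\<^bsub>N\<^esub> (a div q)) \<otimes>\<^bsub>F\<^esub> z [^]\<^bsub>F\<^esub> (a mod q)"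
      using that q_pos by (intro small) auto
    also have "\<dots> = \<phi> e \<otimes>\<^bsub>F\<^esub> (z [^]\<^bsub>F\<^esub> (q * (a div q)) \<otimes>\<^bsub>F\<^esub> z [^]\<^bsub>F\<^esub> (a mod q))"
      using that assms(3)
      by (simp add: F.nat_pow_pow[symmetric] z_pow phi.hom_nat_pow F.m_assoc del: F.nat_pow_mult)
    also have "\<dots> = \<phi> e \<otimes>\<^bsub>F\<^esub> z [^]\<^bsub>F\<^esub> a"
      using assms(3) by (simp add: F.nat_pow_mult)
    finally show ?thesis .
  qed
  have z_pow_swap: "z [^]\<^bsub>F\<^esub> a \<otimes>\<^bsub>F\<^esub> \<phi> e = \<phi> ((\<sigma> ^^ a) e) \<otimes>\<^bsub>F\<^esub> z [^]\<^bsub>F\<^esub> a" if "e \<in> carrier N" for e and a :: nat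
  proof (induction a)
    case (Suc a)
    have "z [^]\<^bsub>F\<^esub> Suc a \<otimes>\<^bsub>F\<^esub> \<phi> e = z \<otimes>\<^bsub>F\<^esub> (z [^]\<^bsub>F\<^esub> a \<otimes>\<^bsub>F\<^esub> \<phi> e)"
      using assms(3) that by (simp only: F.nat_pow_Suc2 F.m_assoc F.nat_pow_closed phi.hom_closed)
    also have "\<dots> = (z \<otimes>\<^bsub>F\<^esub> \<phi> ((\<sigma> ^^ a) e)) \<otimes>\<^bsub>F\<^esub> z [^]\<^bsub>F\<^esub> a"
      using assms(3) that Suc by (simp add: F.m_assoc)
    also have "\<dots> = \<phi> ((\<sigma> ^^ Suc a) e) \<otimes>\<^bsub>F\<^esub> (z \<otimes>\<^bsub>F\<^esub> z [^]\<^bsub>F\<^esub> a)"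
      using assms(3) that by (simp add: z_swap F.m_assoc)
    finally show ?case using assms(3) by (simp only: F.nat_pow_Suc2)
  qed (use that in simp)
  have "\<psi> \<in> hom E F"
  proof (rule homI)
    fix p assume "p \<in> carrier E"
    then obtain e a where "e \<in> carrier N" "p = \<kappa> e \<otimes>\<^bsub>E\<^esub> y [^]\<^bsub>E\<^esub> (a::nat)"
      using normal_form by blast
    then show "\<psi> p \<in> carrier F" using assms(3) by (simp add: psi)
  next
    fix p r assume "p \<in> carrier E" "r \<in> carrier E"
    then obtain e a f b where ef: "e \<in> carrier N" "f \<in> carrier N"
      and p: "p = \<kappa> e \<otimes>\<^bsub>E\<^esub> y [^]\<^bsub>E\<^esub> (a::nat)" and r: "r = \<kappa> f \<otimes>\<^bsub>E\<^esub> y [^]\<^bsub>E\<^esub> (b::nat)"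
      using normal_form by metis
    have "p \<otimes>\<^bsub>E\<^esub> r = \<kappa> e \<otimes>\<^bsub>E\<^esub> ((y [^]\<^bsub>E\<^esub> a \<otimes>\<^bsub>E\<^esub> \<kappa> f) \<otimes>\<^bsub>E\<^esub> y [^]\<^bsub>E\<^esub> b)"
      using ef by (simp add: p r E.m_assoc)
    also have "\<dots> = \<kappa> (e \<otimes>\<^bsub>N\<^esub> (\<sigma> ^^ a) f) \<otimes>\<^bsub>E\<^esub> y [^]\<^bsub>E\<^esub> (a + b)"
      using ef by (simp add: y_pow_swap E.nat_pow_mult[symmetric] E.m_assoc)
    finally have "\<psi> (p \<otimes>\<^bsub>E\<^esub> r) = \<phi> (e \<otimes>\<^bsub>N\<^esub> (\<sigma> ^^ a) f) \<otimes>\<^bsub>F\<^esub> z [^]\<^bsub>F\<^esub> (a + b)"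
      using ef by (simp add: psi del: kappa.hom_mult)
    also have "\<dots> = \<phi> e \<otimes>\<^bsub>F\<^esub> ((\<phi> ((\<sigma> ^^ a) f) \<otimes>\<^bsub>F\<^esub> z [^]\<^bsub>F\<^esub> a) \<otimes>\<^bsub>F\<^esub> z [^]\<^bsub>F\<^esub> b)"
      using ef assms(3) by (simp add: F.nat_pow_mult[symmetric] F.m_assoc)
    also have "\<dots> = \<psi> p \<otimes>\<^bsub>F\<^esub> \<psi> r"
      unfolding z_pow_swap[OF ef(2), symmetric] using ef assms(3) by (simp add: p r psi F.m_assoc)
    finally show "\<psi> (p \<otimes>\<^bsub>E\<^esub> r) = \<psi> p \<otimes>\<^bsub>F\<^esub> \<psi> r" .
  qed
  moreover have "\<psi> (\<kappa> e) = \<phi> e" if "e \<in> carrier N" for e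
    using psi[OF that, of 0] that by simp
  \<comment> \<open>For \<open>q = 1\<close> the exponent 1 is not reduced, so the unbounded
    \<open>psi\<close> is used.\<close>
  moreover have "\<psi> y = z"
    using psi[of "\<one>\<^bsub>N\<^esub>" 1] assms(3) by simp
  ultimately show ?thesis by blast
qed

text \<open>Lets generation by \<open>W\<close> and the lifts pass from one stage to the
  next.\<close>

lemma carrier_generate:
  assumes "carrier N = generate N S" "S \<subseteq> carrier N"
  shows "carrier E = generate E (insert y (\<kappa> ` S))"
proof
  have sub: "insert y (\<kappa> ` S) \<subseteq> carrier E" using assms(2) by auto
  then show "generate E (insert y (\<kappa> ` S)) \<subseteq> carrier E"
    using E.generate_incl by blast
  interpret K: subgroup "generate E (insert y (\<kappa> ` S))" E
    by (rule E.generate_is_subgroup[OF sub])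
  have kappa_in: "\<kappa> e \<in> generate E (insert y (\<kappa> ` S))" if "e \<in> carrier N" for e
  proof -
    have "\<kappa> e \<in> \<kappa> ` generate N S" using that assms(1) by blast
    also have "\<dots> = generate E (\<kappa> ` S)" by (rule kappa.generate_img[OF assms(2), symmetric])
    also have "\<dots> \<subseteq> generate E (insert y (\<kappa> ` S))" by (intro E.mono_generate) auto
    finally show ?thesis .
  qed
  have "y \<in> generate E (insert y (\<kappa> ` S))" by (simp add: generate.incl)
  then have "y [^]\<^bsub>E\<^esub> (a::nat) \<in> generate E (insert y (\<kappa> ` S))" for a
    by (induction a) auto
  then show "carrier E \<subseteq> generate E (insert y (\<kappa> ` S))"
    using normal_form kappa_in by (metis K.m_closed subsetI)
qed

end

text \<open>The product is the one forced on the normal forms \<open>e y\<^sup>a\<close>, \<open>0 \<le> a < q\<close>. The type of the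
  extension is left to the encoding so that the construction can be iterated within one type.\<close>

lemma cyclic_extension_exists:
  fixes N :: "('a, 'm) monoid_scheme" and enc :: "'a \<times> nat \<Rightarrow> 'e"
  assumes "group N" "inj enc" "\<sigma> \<in> hom N N" "c \<in> carrier N" "\<sigma> c = c" "0 < q"
    and sigma_pow: "\<And>e. e \<in> carrier N \<Longrightarrow> c \<otimes>\<^bsub>N\<^esub> e = (\<sigma> ^^ q) e \<otimes>\<^bsub>N\<^esub> c"
  shows "\<exists>(E :: 'e monoid) \<kappa> y. cyclic_extension N E \<sigma> c q \<kappa> y"
proof -
  interpret N: group N by fact
  interpret sigma: group_hom N N \<sigma>
    by (intro group_hom.intro group_hom_axioms.intro assms N.is_group)
  note c = \<open>c \<in> carrier N\<close>
  have sc [simp]: "(\<sigma> ^^ a) e \<in> carrier N" if "e \<in> carrier N" for e a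
    using that by (induction a) simp_all
  have sm: "(\<sigma> ^^ a) (e \<otimes>\<^bsub>N\<^esub> f) = (\<sigma> ^^ a) e \<otimes>\<^bsub>N\<^esub> (\<sigma> ^^ a) f" if "e \<in> carrier N" "f \<in> carrier N" for e f a
    using that by (induction a) simp_all
  have sck: "(\<sigma> ^^ a) (c [^]\<^bsub>N\<^esub> k) = c [^]\<^bsub>N\<^esub> k" for a and k :: nat
    by (induction a) (simp_all add: sigma.hom_nat_pow c assms(5))
  \<comment> \<open>By iterating \<open>sigma_pow\<close>, the \<open>k\<close>-th power of
    \<open>c\<close> acts as \<open>\<sigma> ^^ (q * k)\<close>. Associativity of the product rests
    on this.\<close>
  have ck_swap: "c [^]\<^bsub>N\<^esub> k \<otimes>\<^bsub>N\<^esub> e = (\<sigma> ^^ (q * k)) e \<otimes>\<^bsub>N\<^esub> c [^]\<^bsub>N\<^esub> k" if "e \<in> carrier N" for e and k :: nat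
    using that
  proof (induction k arbitrary: e)
    case (Suc k)
    have "c [^]\<^bsub>N\<^esub> Suc k \<otimes>\<^bsub>N\<^esub> e = c [^]\<^bsub>N\<^esub> k \<otimes>\<^bsub>N\<^esub> (c \<otimes>\<^bsub>N\<^esub> e)"
      using Suc.prems c by (simp add: N.m_assoc)
    also have "\<dots> = (c [^]\<^bsub>N\<^esub> k \<otimes>\<^bsub>N\<^esub> (\<sigma> ^^ q) e) \<otimes>\<^bsub>N\<^esub> c"
      using Suc.prems c by (simp add: sigma_pow N.m_assoc)
    also have "\<dots> = (\<sigma> ^^ (q * Suc k)) e \<otimes>\<^bsub>N\<^esub> c [^]\<^bsub>N\<^esub> Suc k"
      using Suc.prems c
      by (simp add: Suc.IH N.m_assoc funpow_add[unfolded fun_eq_iff o_apply, rule_format, symmetric] add.commute)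
    finally show ?case .
  qed simp
  \<comment> \<open>Moving the \<open>a\<close>-th power of \<open>y\<close> past \<open>f\<close>
    applies \<open>\<sigma> ^^ a\<close>, and a full \<open>q\<close> in the exponent
    \<open>a + b\<close> is carried into \<open>N\<close> as a factor \<open>c\<close>.\<close>
  define mu where "mu p r = (let (e, a) = inv_into UNIV enc p; (f, b) = inv_into UNIV enc r in
      enc (e \<otimes>\<^bsub>N\<^esub> (\<sigma> ^^ a) f \<otimes>\<^bsub>N\<^esub> c [^]\<^bsub>N\<^esub> ((a + b) div q), (a + b) mod q))" for p r
  define E where "E = \<lparr>carrier = enc ` (carrier N \<times> {..<q}), monoid.mult = mu, one = enc (\<one>\<^bsub>N\<^esub>, 0)\<rparr>"
  have mult: "enc (e, a) \<otimes>\<^bsub>E\<^esub> enc (f, b) =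
      enc (e \<otimes>\<^bsub>N\<^esub> (\<sigma> ^^ a) f \<otimes>\<^bsub>N\<^esub> c [^]\<^bsub>N\<^esub> ((a + b) div q), (a + b) mod q)" for e a f b
    by (simp add: E_def mu_def inv_f_f[OF assms(2)])
  have one: "\<one>\<^bsub>E\<^esub> = enc (\<one>\<^bsub>N\<^esub>, 0)" and car: "carrier E = enc ` (carrier N \<times> {..<q})"
    by (simp_all add: E_def)
  have in_car: "enc (e, a) \<in> carrier E" if "e \<in> carrier N" "a < q" for e a
    using that by (auto simp: car)
  have carE: "\<exists>e a. e \<in> carrier N \<and> a < q \<and> p = enc (e, a)" if "p \<in> carrier E" for p
    using that by (auto simp: car)
  have grp: "group E"
  proof (rule groupI)
    fix p r assume "p \<in> carrier E" "r \<in> carrier E"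
    then show "p \<otimes>\<^bsub>E\<^esub> r \<in> carrier E"
      using carE c \<open>0 < q\<close> by (metis mult in_car N.m_closed N.nat_pow_closed sc mod_less_divisor)
  next
    show "\<one>\<^bsub>E\<^esub> \<in> carrier E" using \<open>0 < q\<close> by (simp add: one in_car)
  next
    fix p assume "p \<in> carrier E"
    then obtain e a where p: "e \<in> carrier N" "a < q" "p = enc (e, a)" using carE by blast
    then show "\<one>\<^bsub>E\<^esub> \<otimes>\<^bsub>E\<^esub> p = p" by (simp add: one mult)
    \<comment> \<open>The outer \<open>mod q\<close> gives \<open>b = 0\<close> for
      \<open>a = 0\<close>, keeping the exponent below \<open>q\<close>; \<open>f\<close> then
      cancels what remains in \<open>N\<close>.\<close>
    define b where "b = (q - a) mod q"
    define f where "f = inv\<^bsub>N\<^esub> ((\<sigma> ^^ b) e \<otimes>\<^bsub>N\<^esub> c [^]\<^bsub>N\<^esub> ((b + a) div q))"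
    have "(b + a) mod q = 0" using p by (simp add: b_def mod_simps)
    then have "enc (f, b) \<otimes>\<^bsub>E\<^esub> p = \<one>\<^bsub>E\<^esub>"
      using p c by (simp add: mult one f_def N.m_assoc)
    moreover have "enc (f, b) \<in> carrier E"
      using p c \<open>0 < q\<close> by (intro in_car) (auto simp: f_def b_def)
    ultimately show "\<exists>r\<in>carrier E. r \<otimes>\<^bsub>E\<^esub> p = \<one>\<^bsub>E\<^esub>" by blast
  next
    fix p1 p2 p3 assume "p1 \<in> carrier E" "p2 \<in> carrier E" "p3 \<in> carrier E"
    then obtain e a f b h d where p: "e \<in> carrier N" "f \<in> carrier N" "h \<in> carrier N"
      "p1 = enc (e, a)" "p2 = enc (f, b)" "p3 = enc (h, d)"
      using carE by metis
    define A where "A = e \<otimes>\<^bsub>N\<^esub> (\<sigma> ^^ a) f \<otimes>\<^bsub>N\<^esub> (\<sigma> ^^ (a + b)) h"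
    have A: "A \<in> carrier N" using p by (simp add: A_def)
    \<comment> \<open>Successive carries add up to the carry of the whole sum, so both bracketings
      of three exponents carry equally.\<close>
    have dq: "x div q + (x mod q + z) div q = (x + z) div q" for x z :: nat
    proof -
      have "x + z = x mod q + z + q * (x div q)" by simp
      then have "(x + z) div q = (x mod q + z + q * (x div q)) div q" by (rule arg_cong)
      also have "\<dots> = x div q + (x mod q + z) div q"
        using \<open>0 < q\<close> by (intro div_mult_self2) simp
      finally show ?thesis by (rule sym)
    qed
    \<comment> \<open>The carry of the first product stands left of \<open>h\<close>; moving it
      across restores the multiple of \<open>q\<close> lost in \<open>(a + b) mod q\<close>.\<close>
    have "c [^]\<^bsub>N\<^esub> ((a + b) div q) \<otimes>\<^bsub>N\<^esub> (\<sigma> ^^ ((a + b) mod q)) h =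
        (\<sigma> ^^ (q * ((a + b) div q) + (a + b) mod q)) h \<otimes>\<^bsub>N\<^esub> c [^]\<^bsub>N\<^esub> ((a + b) div q)"
      unfolding funpow_add[of "q * _"] o_apply by (rule ck_swap[OF sc[OF p(3)]])
    also have "q * ((a + b) div q) + (a + b) mod q = a + b" by simp
    finally have swap: "c [^]\<^bsub>N\<^esub> ((a + b) div q) \<otimes>\<^bsub>N\<^esub> (\<sigma> ^^ ((a + b) mod q)) h =
        (\<sigma> ^^ (a + b)) h \<otimes>\<^bsub>N\<^esub> c [^]\<^bsub>N\<^esub> ((a + b) div q)" .
    have "(p1 \<otimes>\<^bsub>E\<^esub> p2) \<otimes>\<^bsub>E\<^esub> p3 = enc (e \<otimes>\<^bsub>N\<^esub> (\<sigma> ^^ a) f \<otimes>\<^bsub>N\<^esub>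
        (c [^]\<^bsub>N\<^esub> ((a + b) div q) \<otimes>\<^bsub>N\<^esub> (\<sigma> ^^ ((a + b) mod q)) h) \<otimes>\<^bsub>N\<^esub>
        c [^]\<^bsub>N\<^esub> (((a + b) mod q + d) div q), (a + b + d) mod q)"
      using p c by (simp add: mult N.m_assoc mod_simps)
    also have "\<dots> = enc (A \<otimes>\<^bsub>N\<^esub> c [^]\<^bsub>N\<^esub> ((a + b) div q + ((a + b) mod q + d) div q), (a + b + d) mod q)"
      unfolding swap using p c by (simp add: A_def N.m_assoc N.nat_pow_mult[symmetric])
    also have "\<dots> = enc (A \<otimes>\<^bsub>N\<^esub> c [^]\<^bsub>N\<^esub> ((a + b + d) div q), (a + b + d) mod q)"
      by (simp only: dq)
    also have "\<dots> = enc (A \<otimes>\<^bsub>N\<^esub> c [^]\<^bsub>N\<^esub> ((b + d) div q + ((b + d) mod q + a) div q), (a + b + d) mod q)"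
      by (simp only: dq) (simp add: ac_simps)
    also have "\<dots> = p1 \<otimes>\<^bsub>E\<^esub> (p2 \<otimes>\<^bsub>E\<^esub> p3)"
      using p c by (simp add: A_def mult sm sck N.m_assoc N.nat_pow_mult[symmetric] mod_simps add.commute add.left_commute funpow_add)
    finally show "(p1 \<otimes>\<^bsub>E\<^esub> p2) \<otimes>\<^bsub>E\<^esub> p3 = p1 \<otimes>\<^bsub>E\<^esub> (p2 \<otimes>\<^bsub>E\<^esub> p3)" .
  qed
  interpret E: group E by (rule grp)
  define \<kappa> where "\<kappa> e = enc (e, 0)" for e
  \<comment> \<open>This is \<open>enc (c, 0)\<close> for \<open>q = 1\<close>, where the new
    element already lies in \<open>N\<close>, and has \<open>N\<close>-part one and exponent 1
    otherwise.\<close>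
  define y where "y = enc (c [^]\<^bsub>N\<^esub> (1 div q), 1 mod q)"
  have y: "y \<in> carrier E" using c \<open>0 < q\<close> by (auto simp: y_def intro!: in_car)
  have ypow: "y [^]\<^bsub>E\<^esub> a = enc (c [^]\<^bsub>N\<^esub> (a div q), a mod q)" for a :: nat
  proof (induction a)
    case (Suc a)
    have "y [^]\<^bsub>E\<^esub> Suc a = enc (c [^]\<^bsub>N\<^esub> (a div q + 1 div q + (a mod q + 1 mod q) div q), (a mod q + 1 mod q) mod q)"
      unfolding E.nat_pow_Suc Suc unfolding y_def mult sck using c by (simp only: N.nat_pow_mult)
    also have "a div q + 1 div q + (a mod q + 1 mod q) div q = Suc a div q"
      using div_add1_eq[of a 1 q] by simp
    also have "(a mod q + 1 mod q) mod q = Suc a mod q" by (simp add: mod_simps)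
    finally show ?case .
  qed (simp add: one)
  have nf: "\<kappa> e \<otimes>\<^bsub>E\<^esub> y [^]\<^bsub>E\<^esub> a = enc (e \<otimes>\<^bsub>N\<^esub> c [^]\<^bsub>N\<^esub> (a div q), a mod q)" if "e \<in> carrier N" for e and a :: nat
    using that c by (simp add: \<kappa>_def ypow mult)
  have "cyclic_extension N E \<sigma> c q \<kappa> y"
  proof
    show "0 < q" "\<sigma> \<in> hom N N" "c \<in> carrier N" "y \<in> carrier E" by fact+
    show "\<kappa> \<in> hom N E"
      using \<open>0 < q\<close> by (intro homI) (auto simp: \<kappa>_def mult intro!: in_car)
    show "y [^]\<^bsub>E\<^esub> q = \<kappa> c" using \<open>0 < q\<close> c by (simp add: ypow \<kappa>_def)
    fix e assume e: "e \<in> carrier N"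
    \<comment> \<open>For \<open>q = 1\<close> this is \<open>sigma_pow\<close>; otherwise both
      powers of \<open>c\<close> are trivial.\<close>
    have "c [^]\<^bsub>N\<^esub> (1 div q) \<otimes>\<^bsub>N\<^esub> (\<sigma> ^^ (1 mod q)) e = \<sigma> e \<otimes>\<^bsub>N\<^esub> c [^]\<^bsub>N\<^esub> (1 div q)"
      using e c \<open>0 < q\<close> sigma_pow[OF e] by (cases "q = 1") (auto simp: N.nat_pow_eone)
    then show "y \<otimes>\<^bsub>E\<^esub> \<kappa> e = \<kappa> (\<sigma> e) \<otimes>\<^bsub>E\<^esub> y"
      using e c by (simp add: y_def \<kappa>_def mult)
  next
    fix p assume "p \<in> carrier E"
    then obtain e a where p: "e \<in> carrier N" "a < q" "p = enc (e, a)" using carE by blast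
    then have "p = \<kappa> e \<otimes>\<^bsub>E\<^esub> y [^]\<^bsub>E\<^esub> a" by (simp add: nf)
    then show "\<exists>e\<in>carrier N. \<exists>a<q. p = \<kappa> e \<otimes>\<^bsub>E\<^esub> y [^]\<^bsub>E\<^esub> a" using p by blast
  next
    fix e f a b
    assume "e \<in> carrier N" "f \<in> carrier N" "a < q" "b < q"
      "\<kappa> e \<otimes>\<^bsub>E\<^esub> y [^]\<^bsub>E\<^esub> a = \<kappa> f \<otimes>\<^bsub>E\<^esub> y [^]\<^bsub>E\<^esub> b"
    then show "e = f \<and> a = b" by (simp add: nf inj_eq[OF assms(2)])
  qed
  then show ?thesis by blast
qed

section \<open>Extensions of a group by a module\<close>

locale module_action = W: comm_group W + G: comm_group G
  for W :: "('w, 'm) monoid_scheme" and G :: "('g, 'k) monoid_scheme" +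
  fixes \<Upsilon> :: "'g \<Rightarrow> 'w \<Rightarrow> 'w"
  assumes action_hom: "\<Upsilon> \<in> hom G (AutoGroup W)"
begin

lemma action_auto: "a \<in> carrier G \<Longrightarrow> \<Upsilon> a \<in> hom W W"
  using action_hom by (auto simp: hom_def AutoGroup_def auto_def)

lemma action_closed [simp]: "a \<in> carrier G \<Longrightarrow> w \<in> carrier W \<Longrightarrow> \<Upsilon> a w \<in> carrier W"
  using action_auto by (auto simp: hom_def)

lemma action_mult [simp]:
  "a \<in> carrier G \<Longrightarrow> v \<in> carrier W \<Longrightarrow> w \<in> carrier W \<Longrightarrow> \<Upsilon> a (v \<otimes>\<^bsub>W\<^esub> w) = \<Upsilon> a v \<otimes>\<^bsub>W\<^esub> \<Upsilon> a w"
  using action_auto by (auto simp: hom_def)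

lemma action_W_one [simp]: "a \<in> carrier G \<Longrightarrow> \<Upsilon> a \<one>\<^bsub>W\<^esub> = \<one>\<^bsub>W\<^esub>"
  using hom_one[OF action_auto W.is_group W.is_group] .

lemma action_inv: "a \<in> carrier G \<Longrightarrow> w \<in> carrier W \<Longrightarrow> \<Upsilon> a (inv\<^bsub>W\<^esub> w) = inv\<^bsub>W\<^esub> (\<Upsilon> a w)"
  by (metis W.inv_closed W.inv_equality W.l_inv action_W_one action_closed action_mult)

lemma action_comp:
  assumes "a \<in> carrier G" "b \<in> carrier G" "w \<in> carrier W"
  shows "\<Upsilon> (a \<otimes>\<^bsub>G\<^esub> b) w = \<Upsilon> a (\<Upsilon> b w)"
proof -
  have "\<Upsilon> a \<in> Bij (carrier W)" "\<Upsilon> b \<in> Bij (carrier W)"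
    using action_hom assms by (auto simp: hom_def AutoGroup_def auto_def)
  moreover have "\<Upsilon> (a \<otimes>\<^bsub>G\<^esub> b) = \<Upsilon> a \<otimes>\<^bsub>AutoGroup W\<^esub> \<Upsilon> b"
    using action_hom assms by (simp add: hom_def)
  ultimately show ?thesis
    using assms by (simp add: AutoGroup_def BijGroup_def compose_def)
qed

lemma action_one [simp]:
  assumes "w \<in> carrier W"
  shows "\<Upsilon> \<one>\<^bsub>G\<^esub> w = w"
proof -
  have "\<Upsilon> \<one>\<^bsub>G\<^esub> = \<one>\<^bsub>AutoGroup W\<^esub>"
    using hom_one[OF action_hom G.is_group W.AutoGroup] .
  then show ?thesis using assms by (simp add: AutoGroup_def BijGroup_def)
qed

text \<open>Turns the iterates in \<open>norm_prod\<close> into actions of powers in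
  \<open>G\<close>, which is how powers of lifts act.\<close>

lemma action_funpow:
  assumes "a \<in> carrier G" "w \<in> carrier W"
  shows "(\<Upsilon> a ^^ s) w = \<Upsilon> (a [^]\<^bsub>G\<^esub> s) w"
proof (induction s)
  case (Suc s)
  have "(\<Upsilon> a ^^ Suc s) w = \<Upsilon> (a \<otimes>\<^bsub>G\<^esub> a [^]\<^bsub>G\<^esub> s) w"
    using Suc assms by (simp add: action_comp)
  then show ?case using assms by (simp add: G.m_comm)
qed (simp add: assms)

lemma norm_prod_closed [simp]:
  assumes "a \<in> carrier G" "w \<in> carrier W"
  shows "norm_prod W (\<Upsilon> a) s w \<in> carrier W"
  unfolding norm_prod_def using assms by (auto intro!: W.finprod_closed simp: action_funpow)

lemma norm_prod_0 [simp]: "norm_prod W (\<Upsilon> a) 0 w = \<one>\<^bsub>W\<^esub>"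
  by (simp add: norm_prod_def)

lemma norm_prod_Suc:
  assumes "a \<in> carrier G" "w \<in> carrier W"
  shows "norm_prod W (\<Upsilon> a) (Suc s) w = norm_prod W (\<Upsilon> a) s w \<otimes>\<^bsub>W\<^esub> \<Upsilon> (a [^]\<^bsub>G\<^esub> s) w"
  unfolding norm_prod_def lessThan_Suc using assms
  by (subst W.finprod_insert) (auto simp: action_funpow W.m_comm intro!: W.finprod_closed)

lemma norm_prod_W_one:
  assumes "a \<in> carrier G"
  shows "norm_prod W (\<Upsilon> a) s \<one>\<^bsub>W\<^esub> = \<one>\<^bsub>W\<^esub>"
  unfolding norm_prod_def using assms by (simp add: action_funpow W.finprod_one)

lemma norm_prod_inv:
  assumes "a \<in> carrier G" "w \<in> carrier W"
  shows "norm_prod W (\<Upsilon> a) s (inv\<^bsub>W\<^esub> w) = inv\<^bsub>W\<^esub> (norm_prod W (\<Upsilon> a) s w)"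
  by (induction s) (simp_all add: assms norm_prod_Suc action_inv W.inv_mult)

text \<open>The product on the right of C3, with \<open>b k\<close> for \<open>\<beta> k j\<close>
  and \<open>s\<close> for \<open>t i\<close>.\<close>

definition twisted_prod :: "(nat \<Rightarrow> 'g) \<Rightarrow> (nat \<Rightarrow> nat) \<Rightarrow> (nat \<Rightarrow> 'w) \<Rightarrow> nat \<Rightarrow> 'w"
  where "twisted_prod g s b i = finprod W
    (\<lambda>k. foldr (\<lambda>l. \<Upsilon> (g l) ^^ s l) [1..<k] (norm_prod W (\<Upsilon> (g k)) (s k) (b k))) {1..<i}"

lemma foldr_action_closed:
  assumes "\<And>l. l \<in> set ls \<Longrightarrow> g l \<in> carrier G" "w \<in> carrier W"
  shows "foldr (\<lambda>l. \<Upsilon> (g l) ^^ s l) ls w \<in> carrier W"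
  using assms by (induction ls) (simp_all add: action_funpow)

lemma twisted_factor_closed:
  assumes "\<And>l. l \<in> {1..<Suc k} \<Longrightarrow> g l \<in> carrier G" "b k \<in> carrier W" "1 \<le> k"
  shows "foldr (\<lambda>l. \<Upsilon> (g l) ^^ s l) [1..<k] (norm_prod W (\<Upsilon> (g k)) (s k) (b k)) \<in> carrier W"
  using assms by (intro foldr_action_closed norm_prod_closed) auto

lemma twisted_prod_closed:
  assumes "\<And>l. l \<in> {1..<i} \<Longrightarrow> g l \<in> carrier G" "\<And>l. l \<in> {1..<i} \<Longrightarrow> b l \<in> carrier W"
  shows "twisted_prod g s b i \<in> carrier W"
  unfolding twisted_prod_def
  using assms by (auto intro!: W.finprod_closed twisted_factor_closed[unfolded One_nat_def])

lemma twisted_prod_Suc: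
  assumes "\<And>l. l \<in> {1..<Suc i} \<Longrightarrow> g l \<in> carrier G" "\<And>l. l \<in> {1..<Suc i} \<Longrightarrow> b l \<in> carrier W" "1 \<le> i"
  shows "twisted_prod g s b (Suc i) = twisted_prod g s b i \<otimes>\<^bsub>W\<^esub>
    foldr (\<lambda>l. \<Upsilon> (g l) ^^ s l) [1..<i] (norm_prod W (\<Upsilon> (g i)) (s i) (b i))"
proof -
  have *: "{1..<Suc i} = insert i {1..<i}" using assms(3) by auto
  have "twisted_prod g s b i \<in> carrier W" using assms by (intro twisted_prod_closed) auto
  moreover have "foldr (\<lambda>l. \<Upsilon> (g l) ^^ s l) [1..<k] (norm_prod W (\<Upsilon> (g k)) (s k) (b k)) \<in> carrier W"
    if "k \<in> {1..<Suc i}" for k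
    using assms that by (intro twisted_factor_closed) auto
  ultimately show ?thesis
    using assms(3) unfolding twisted_prod_def *
    by (subst W.finprod_insert) (auto simp: W.m_comm)
qed

end

text \<open>\<open>\<pi>\<close> is a homomorphism into \<open>G\<close> only, since a stage of the
  construction reaches just the subgroup generated by the generators treated so far. The induced
  action is written as a swap rule to keep inverses out of computations.\<close>

locale group_extension = module_action W G \<Upsilon> + E: group E
  for W :: "('w, 'm) monoid_scheme" and G :: "('g, 'k) monoid_scheme" and \<Upsilon>
    and E :: "('e, 'l) monoid_scheme" +
  fixes \<iota> :: "'w \<Rightarrow> 'e" and \<pi> :: "'e \<Rightarrow> 'g"
  assumes iota_hom: "\<iota> \<in> hom W E" and iota_inj: "inj_on \<iota> (carrier W)"
    and pi_hom: "\<pi> \<in> hom E G"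
    and kernel_eq: "kernel E G \<pi> = \<iota> ` carrier W"
    and iota_swap: "\<And>e w. e \<in> carrier E \<Longrightarrow> w \<in> carrier W \<Longrightarrow>
      e \<otimes>\<^bsub>E\<^esub> \<iota> w = \<iota> (\<Upsilon> (\<pi> e) w) \<otimes>\<^bsub>E\<^esub> e"
begin

sublocale iota: group_hom W E \<iota>
  by (intro group_hom.intro group_hom_axioms.intro iota_hom W.is_group E.is_group)

sublocale pi: group_hom E G \<pi>
  by (intro group_hom.intro group_hom_axioms.intro pi_hom G.is_group E.is_group)

lemma pi_iota [simp]: "w \<in> carrier W \<Longrightarrow> \<pi> (\<iota> w) = \<one>\<^bsub>G\<^esub>"
  using kernel_eq by (auto simp: kernel_def)

lemma iota_eq_iff: "v \<in> carrier W \<Longrightarrow> w \<in> carrier W \<Longrightarrow> \<iota> v = \<iota> w \<longleftrightarrow> v = w"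
  using iota_inj by (auto simp: inj_on_def)

lemma iota_swap_left:
  assumes "e \<in> carrier E" "f \<in> carrier E" "w \<in> carrier W"
  shows "e \<otimes>\<^bsub>E\<^esub> (\<iota> w \<otimes>\<^bsub>E\<^esub> f) = \<iota> (\<Upsilon> (\<pi> e) w) \<otimes>\<^bsub>E\<^esub> (e \<otimes>\<^bsub>E\<^esub> f)"
  using assms by (simp add: E.m_assoc[symmetric] iota_swap)

lemma iota_mult_left:
  assumes "f \<in> carrier E" "v \<in> carrier W" "w \<in> carrier W"
  shows "\<iota> v \<otimes>\<^bsub>E\<^esub> (\<iota> w \<otimes>\<^bsub>E\<^esub> f) = \<iota> (v \<otimes>\<^bsub>W\<^esub> w) \<otimes>\<^bsub>E\<^esub> f"
  using assms by (simp add: E.m_assoc[symmetric])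

text \<open>The source of the norms: when the copies of \<open>w\<close> are collected on the left,
  each one is acted on by the power of \<open>\<pi> e\<close> that it has to pass.\<close>

lemma pow_iota_mult:
  assumes "e \<in> carrier E" "w \<in> carrier W"
  shows "(\<iota> w \<otimes>\<^bsub>E\<^esub> e) [^]\<^bsub>E\<^esub> s = \<iota> (norm_prod W (\<Upsilon> (\<pi> e)) s w) \<otimes>\<^bsub>E\<^esub> e [^]\<^bsub>E\<^esub> s"
proof (induction s)
  case (Suc s)
  let ?N = "norm_prod W (\<Upsilon> (\<pi> e)) s w"
  have "(\<iota> w \<otimes>\<^bsub>E\<^esub> e) [^]\<^bsub>E\<^esub> Suc s = \<iota> ?N \<otimes>\<^bsub>E\<^esub> (e [^]\<^bsub>E\<^esub> s \<otimes>\<^bsub>E\<^esub> (\<iota> w \<otimes>\<^bsub>E\<^esub> e))"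
    using Suc assms by (simp add: E.m_assoc)
  also have "\<dots> = \<iota> (?N \<otimes>\<^bsub>W\<^esub> \<Upsilon> (\<pi> e [^]\<^bsub>G\<^esub> s) w) \<otimes>\<^bsub>E\<^esub> (e [^]\<^bsub>E\<^esub> s \<otimes>\<^bsub>E\<^esub> e)"
    using assms
    by (subst iota_swap_left) (simp_all add: iota_mult_left pi.hom_nat_pow del: iota.hom_mult)
  finally show ?case using assms by (simp add: norm_prod_Suc)
qed (use assms in simp)

end

section \<open>Ordered words in the lifts of the generators\<close>

locale extension_with_lifts = group_extension W G \<Upsilon> E \<iota> \<pi>
  for W :: "('w, 'm) monoid_scheme" and G :: "('g, 'k) monoid_scheme" and \<Upsilon>
    and E :: "('e, 'l) monoid_scheme" and \<iota> \<pi> +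
  fixes m :: nat and g :: "nat \<Rightarrow> 'g" and x :: "nat \<Rightarrow> 'e"
  assumes x_closed: "\<And>k. k \<in> {1..m} \<Longrightarrow> x k \<in> carrier E"
    and pi_x: "\<And>k. k \<in> {1..m} \<Longrightarrow> \<pi> (x k) = g k"
begin

lemma g_closed: "k \<in> {1..m} \<Longrightarrow> g k \<in> carrier G"
  using pi_x pi.hom_closed x_closed by metis

text \<open>For \<open>s = t i\<close> this is the word in the power relation of \<open>x i\<close>.
  Its last letter has index \<open>i - 1\<close>, so it makes sense for \<open>i = Suc m\<close>,
  before \<open>x i\<close> exists.\<close>

definition word :: "(nat \<Rightarrow> nat) \<Rightarrow> nat \<Rightarrow> 'e"
  where "word s i = list_prod E (map (\<lambda>l. x l [^]\<^bsub>E\<^esub> s l) [1..<i])"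

lemma word_closed: "i \<le> Suc m \<Longrightarrow> word s i \<in> carrier E"
  unfolding word_def
  by (intro list_prod_closed) (auto intro!: E.nat_pow_closed x_closed)

lemma word_Suc:
  assumes "i \<in> {1..m}"
  shows "word s (Suc i) = word s i \<otimes>\<^bsub>E\<^esub> x i [^]\<^bsub>E\<^esub> s i"
  unfolding word_def using assms
  by (simp, subst list_prod_append) (auto simp: list_prod_def x_closed)

lemma pi_word:
  assumes "i \<le> Suc m"
  shows "\<pi> (word s i) = finprod G (\<lambda>j. g j [^]\<^bsub>G\<^esub> s j) {1..<i}"
proof -
  have "\<pi> (word s i) = list_prod G (map \<pi> (map (\<lambda>l. x l [^]\<^bsub>E\<^esub> s l) [1..<i]))"
    unfolding word_def using assms
    by (intro hom_list_prod pi_hom) (auto intro!: E.nat_pow_closed x_closed)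
  also have "map \<pi> (map (\<lambda>l. x l [^]\<^bsub>E\<^esub> s l) [1..<i]) = map (\<lambda>j. g j [^]\<^bsub>G\<^esub> s j) [1..<i]"
    using assms by (auto simp: pi.hom_nat_pow x_closed pi_x)
  also have "list_prod G \<dots> = finprod G (\<lambda>j. g j [^]\<^bsub>G\<^esub> s j) {1..<i}"
    using assms g_closed by (intro list_prod_eq_finprod G.comm_group_axioms) auto
  finally show ?thesis .
qed

text \<open>Moving left, \<open>w\<close> meets the last letter first, which is the order in which
  \<open>foldr\<close> applies the actions.\<close>

lemma word_swap:
  assumes "i \<le> Suc m" "w \<in> carrier W"
  shows "word s i \<otimes>\<^bsub>E\<^esub> \<iota> w = \<iota> (foldr (\<lambda>l. \<Upsilon> (g l) ^^ s l) [1..<i] w) \<otimes>\<^bsub>E\<^esub> word s i"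
proof -
  \<comment> \<open>Stated for arbitrary lists of indices, since removing the first letter does not
    leave a list of the form \<open>[1..<i]\<close>.\<close>
  have "list_prod E (map (\<lambda>l. x l [^]\<^bsub>E\<^esub> s l) ls) \<otimes>\<^bsub>E\<^esub> \<iota> w =
      \<iota> (foldr (\<lambda>l. \<Upsilon> (g l) ^^ s l) ls w) \<otimes>\<^bsub>E\<^esub> list_prod E (map (\<lambda>l. x l [^]\<^bsub>E\<^esub> s l) ls)"
    if "set ls \<subseteq> {1..m}" for ls
    using that
  proof (induction ls)
    case Nil
    then show ?case using assms by (simp add: list_prod_def)
  next
    case (Cons a ls)
    let ?p = "list_prod E (map (\<lambda>l. x l [^]\<^bsub>E\<^esub> s l) ls)"
    let ?v = "foldr (\<lambda>l. \<Upsilon> (g l) ^^ s l) ls w"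
    have xa: "x a \<in> carrier E" "\<pi> (x a) = g a" "g a \<in> carrier G"
      using Cons.prems x_closed pi_x g_closed by auto
    have p: "?p \<in> carrier E"
      using Cons.prems by (intro list_prod_closed) (auto intro!: E.nat_pow_closed x_closed)
    have v: "?v \<in> carrier W"
      using Cons.prems assms by (intro foldr_action_closed g_closed) auto
    have "list_prod E (map (\<lambda>l. x l [^]\<^bsub>E\<^esub> s l) (a # ls)) \<otimes>\<^bsub>E\<^esub> \<iota> w =
        x a [^]\<^bsub>E\<^esub> s a \<otimes>\<^bsub>E\<^esub> (\<iota> ?v \<otimes>\<^bsub>E\<^esub> ?p)"
      using Cons p xa assms by (simp add: list_prod_def E.m_assoc)
    also have "\<dots> = \<iota> (\<Upsilon> (g a [^]\<^bsub>G\<^esub> s a) ?v) \<otimes>\<^bsub>E\<^esub> (x a [^]\<^bsub>E\<^esub> s a \<otimes>\<^bsub>E\<^esub> ?p)"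
      using p v xa by (simp add: iota_swap_left pi.hom_nat_pow)
    finally show ?case using v xa by (simp add: list_prod_def action_funpow)
  qed
  moreover have "set [1..<i] \<subseteq> {1..m}" using assms(1) by auto
  ultimately show ?thesis unfolding word_def by blast
qed

text \<open>How the right side of C3 arises: \<open>pow_iota_mult\<close> turns each factor into a
  norm times a power of a lift, and \<open>word_swap\<close> moves the norm to the front past the
  earlier powers.\<close>

lemma twisted_word:
  assumes "i \<le> Suc m" "\<And>l. l \<in> {1..<i} \<Longrightarrow> b l \<in> carrier W"
  shows "list_prod E (map (\<lambda>l. (\<iota> (b l) \<otimes>\<^bsub>E\<^esub> x l) [^]\<^bsub>E\<^esub> s l) [1..<i]) =
    \<iota> (twisted_prod g s b i) \<otimes>\<^bsub>E\<^esub> word s i"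
  using assms
proof (induction i)
  case 0
  then show ?case by (simp add: list_prod_def word_def twisted_prod_def)
next
  case (Suc i)
  show ?case
  proof (cases "i = 0")
    case True
    then show ?thesis by (simp add: list_prod_def word_def twisted_prod_def)
  next
    case False
    then have i: "i \<in> {1..m}" using Suc.prems by auto
    let ?f = "\<lambda>l. (\<iota> (b l) \<otimes>\<^bsub>E\<^esub> x l) [^]\<^bsub>E\<^esub> s l"
    let ?N = "norm_prod W (\<Upsilon> (g i)) (s i) (b i)"
    let ?v = "foldr (\<lambda>l. \<Upsilon> (g l) ^^ s l) [1..<i] ?N"
    have gc: "g l \<in> carrier G" if "l \<in> {1..<Suc i}" for l using g_closed that i by auto
    have P: "twisted_prod g s b i \<in> carrier W"
      using Suc.prems gc by (intro twisted_prod_closed) auto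
    have N: "?N \<in> carrier W" using Suc.prems i gc by (intro norm_prod_closed) auto
    have v: "?v \<in> carrier W" using N gc by (intro foldr_action_closed) auto
    have fc: "?f l \<in> carrier E" if "l \<in> {1..<Suc i}" for l
      using that i Suc.prems x_closed by auto
    have wc: "word s i \<in> carrier E" using i by (intro word_closed) auto
    have xi: "x i \<in> carrier E" "\<pi> (x i) = g i" using i x_closed pi_x by auto
    have bi: "b i \<in> carrier W" using Suc.prems i by auto
    have "list_prod E (map ?f [1..<Suc i]) = list_prod E (map ?f [1..<i]) \<otimes>\<^bsub>E\<^esub> ?f i"
      using fc False by (simp, subst list_prod_append) (auto simp: list_prod_def)
    also have "\<dots> = \<iota> (twisted_prod g s b i) \<otimes>\<^bsub>E\<^esub> (word s i \<otimes>\<^bsub>E\<^esub> (\<iota> ?N \<otimes>\<^bsub>E\<^esub> x i [^]\<^bsub>E\<^esub> s i))"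
      using Suc.IH Suc.prems P N wc xi bi by (simp add: pow_iota_mult E.m_assoc)
    also have "word s i \<otimes>\<^bsub>E\<^esub> (\<iota> ?N \<otimes>\<^bsub>E\<^esub> x i [^]\<^bsub>E\<^esub> s i) =
        (word s i \<otimes>\<^bsub>E\<^esub> \<iota> ?N) \<otimes>\<^bsub>E\<^esub> x i [^]\<^bsub>E\<^esub> s i"
      using N wc xi by (simp add: E.m_assoc)
    also have "word s i \<otimes>\<^bsub>E\<^esub> \<iota> ?N = \<iota> ?v \<otimes>\<^bsub>E\<^esub> word s i"
      using i N by (intro word_swap) auto
    also have "\<iota> (twisted_prod g s b i) \<otimes>\<^bsub>E\<^esub> (\<iota> ?v \<otimes>\<^bsub>E\<^esub> word s i \<otimes>\<^bsub>E\<^esub> x i [^]\<^bsub>E\<^esub> s i) =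
        \<iota> (twisted_prod g s b i \<otimes>\<^bsub>W\<^esub> ?v) \<otimes>\<^bsub>E\<^esub> (word s i \<otimes>\<^bsub>E\<^esub> x i [^]\<^bsub>E\<^esub> s i)"
      using v P wc xi by (simp add: E.m_assoc)
    finally show ?thesis
      using i gc Suc.prems by (subst word_Suc, simp, subst twisted_prod_Suc) auto
  qed
qed

text \<open>Stated for any \<open>h\<close> that behaves like conjugation by a lift, so that it
  serves both real conjugation by \<open>x j\<close> and the endomorphism \<open>\<tau> j\<close>,
  whose lift may not exist yet.\<close>

lemma hom_word:
  assumes "h \<in> hom E E" "i \<le> Suc m" "a \<in> carrier G" "c \<in> carrier W"
    and "\<And>w. w \<in> carrier W \<Longrightarrow> h (\<iota> w) = \<iota> (\<Upsilon> a w)"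
    and "\<And>l. l \<in> {1..<i} \<Longrightarrow> b l \<in> carrier W"
    and "\<And>l. l \<in> {1..<i} \<Longrightarrow> h (x l) = \<iota> (b l) \<otimes>\<^bsub>E\<^esub> x l"
  shows "h (\<iota> c \<otimes>\<^bsub>E\<^esub> word s i) = \<iota> (\<Upsilon> a c \<otimes>\<^bsub>W\<^esub> twisted_prod g s b i) \<otimes>\<^bsub>E\<^esub> word s i"
proof -
  interpret h: group_hom E E h
    by (intro group_hom.intro group_hom_axioms.intro assms(1)) simp_all
  have P: "twisted_prod g s b i \<in> carrier W"
    using assms g_closed by (intro twisted_prod_closed) auto
  have "h (word s i) = list_prod E (map h (map (\<lambda>l. x l [^]\<^bsub>E\<^esub> s l) [1..<i]))"
    unfolding word_def using assms(2)
    by (intro hom_list_prod assms(1)) (auto intro!: E.nat_pow_closed x_closed)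
  also have "map h (map (\<lambda>l. x l [^]\<^bsub>E\<^esub> s l) [1..<i]) =
      map (\<lambda>l. (\<iota> (b l) \<otimes>\<^bsub>E\<^esub> x l) [^]\<^bsub>E\<^esub> s l) [1..<i]"
    using assms(2,7) x_closed by (auto simp: h.hom_nat_pow)
  also have "list_prod E \<dots> = \<iota> (twisted_prod g s b i) \<otimes>\<^bsub>E\<^esub> word s i"
    using assms by (intro twisted_word) auto
  finally show ?thesis
    using assms P word_closed[OF assms(2)] by (simp add: E.m_assoc)
qed

end

section \<open>The factor set of a section\<close>

context group_extension
begin

text \<open>The product of \<open>u a\<close> and \<open>u b\<close> projects to the same element as
  \<open>u\<close> of the product, so they differ by an element of \<open>W\<close>. The cocycle
  identity compares the two bracketings of the product of \<open>u a\<close>, \<open>u b\<close> and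
  \<open>u c\<close>.\<close>

lemma factor_set_of_section:
  assumes u: "\<And>a. a \<in> carrier G \<Longrightarrow> u a \<in> carrier E" and pu: "\<And>a. a \<in> carrier G \<Longrightarrow> \<pi> (u a) = a"
  shows "\<exists>\<alpha>\<in>factor_sets W G \<Upsilon>. associated_factor_set G E \<iota> u \<alpha>"
proof -
  have "\<exists>w\<in>carrier W. u a \<otimes>\<^bsub>E\<^esub> u b = \<iota> w \<otimes>\<^bsub>E\<^esub> u (a \<otimes>\<^bsub>G\<^esub> b)"
    if "a \<in> carrier G" "b \<in> carrier G" for a b
  proof -
    have "u a \<otimes>\<^bsub>E\<^esub> u b \<otimes>\<^bsub>E\<^esub> inv\<^bsub>E\<^esub> u (a \<otimes>\<^bsub>G\<^esub> b) \<in> kernel E G \<pi>"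
      using that by (simp add: kernel_def u pu)
    then obtain w where w: "w \<in> carrier W" "\<iota> w = u a \<otimes>\<^bsub>E\<^esub> u b \<otimes>\<^bsub>E\<^esub> inv\<^bsub>E\<^esub> u (a \<otimes>\<^bsub>G\<^esub> b)"
      unfolding kernel_eq by auto
    then have "\<iota> w \<otimes>\<^bsub>E\<^esub> u (a \<otimes>\<^bsub>G\<^esub> b) = u a \<otimes>\<^bsub>E\<^esub> u b"
      using that by (simp add: E.m_assoc u)
    then show ?thesis using w(1) by metis
  qed
  then obtain \<alpha> where al: "\<And>a b. a \<in> carrier G \<Longrightarrow> b \<in> carrier G \<Longrightarrow> \<alpha> a b \<in> carrier W"
    and mult: "\<And>a b. a \<in> carrier G \<Longrightarrow> b \<in> carrier G \<Longrightarrow>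
      u a \<otimes>\<^bsub>E\<^esub> u b = \<iota> (\<alpha> a b) \<otimes>\<^bsub>E\<^esub> u (a \<otimes>\<^bsub>G\<^esub> b)"
    by metis
  have "\<alpha> a b \<otimes>\<^bsub>W\<^esub> \<alpha> (a \<otimes>\<^bsub>G\<^esub> b) c = \<Upsilon> a (\<alpha> b c) \<otimes>\<^bsub>W\<^esub> \<alpha> a (b \<otimes>\<^bsub>G\<^esub> c)"
    if abc: "a \<in> carrier G" "b \<in> carrier G" "c \<in> carrier G" for a b c
  proof -
    let ?u = "u (a \<otimes>\<^bsub>G\<^esub> b \<otimes>\<^bsub>G\<^esub> c)"
    have cl: "\<alpha> a b \<in> carrier W" "\<alpha> (a \<otimes>\<^bsub>G\<^esub> b) c \<in> carrier W" "\<alpha> b c \<in> carrier W"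
      "\<alpha> a (b \<otimes>\<^bsub>G\<^esub> c) \<in> carrier W" "?u \<in> carrier E"
      using abc by (simp_all add: al u)
    have "\<iota> (\<alpha> a b \<otimes>\<^bsub>W\<^esub> \<alpha> (a \<otimes>\<^bsub>G\<^esub> b) c) \<otimes>\<^bsub>E\<^esub> ?u = \<iota> (\<alpha> a b) \<otimes>\<^bsub>E\<^esub> (u (a \<otimes>\<^bsub>G\<^esub> b) \<otimes>\<^bsub>E\<^esub> u c)"
      using abc cl by (simp add: mult[of "a \<otimes>\<^bsub>G\<^esub> b" c] E.m_assoc)
    also have "\<dots> = u a \<otimes>\<^bsub>E\<^esub> (u b \<otimes>\<^bsub>E\<^esub> u c)"
      using abc cl by (simp add: mult[of a b] u E.m_assoc[symmetric])
    also have "\<dots> = \<iota> (\<Upsilon> a (\<alpha> b c)) \<otimes>\<^bsub>E\<^esub> (u a \<otimes>\<^bsub>E\<^esub> u (b \<otimes>\<^bsub>G\<^esub> c))"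
      using abc cl by (simp add: mult[of b c] iota_swap_left u pu)
    also have "\<dots> = \<iota> (\<Upsilon> a (\<alpha> b c) \<otimes>\<^bsub>W\<^esub> \<alpha> a (b \<otimes>\<^bsub>G\<^esub> c)) \<otimes>\<^bsub>E\<^esub> ?u"
      using abc cl by (simp add: mult[of a "b \<otimes>\<^bsub>G\<^esub> c"] E.m_assoc G.m_assoc)
    finally have "\<iota> (\<alpha> a b \<otimes>\<^bsub>W\<^esub> \<alpha> (a \<otimes>\<^bsub>G\<^esub> b) c) = \<iota> (\<Upsilon> a (\<alpha> b c) \<otimes>\<^bsub>W\<^esub> \<alpha> a (b \<otimes>\<^bsub>G\<^esub> c))"
      using abc cl by (simp del: iota.hom_mult)
    then show ?thesis using abc cl by (subst (asm) iota_eq_iff) auto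
  qed
  then have "\<alpha> \<in> factor_sets W G \<Upsilon>" using al by (auto simp: factor_sets_def)
  moreover have "associated_factor_set G E \<iota> u \<alpha>"
    using mult by (simp add: associated_factor_set_def)
  ultimately show ?thesis by blast
qed

end

section \<open>Relations between lifts of the generators\<close>

locale presentation_data = module_action W G \<Upsilon>
  for W :: "('w, 'm) monoid_scheme" and G :: "('g, 'k) monoid_scheme" and \<Upsilon> +
  fixes n :: nat and g :: "nat \<Rightarrow> 'g" and q :: "nat \<Rightarrow> nat" and t :: "nat \<Rightarrow> nat \<Rightarrow> nat"
    and \<beta> :: "nat \<Rightarrow> nat \<Rightarrow> 'w" and \<gamma> :: "nat \<Rightarrow> 'w"
  assumes g_in [simp]: "\<And>k. k \<in> {1..n} \<Longrightarrow> g k \<in> carrier G"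
    and beta_in [simp]: "\<And>i j. i \<in> {1..n} \<Longrightarrow> j \<in> {1..n} \<Longrightarrow> \<beta> i j \<in> carrier W"
    and gamma_in [simp]: "\<And>i. i \<in> {1..n} \<Longrightarrow> \<gamma> i \<in> carrier W"

text \<open>\<open>beta_self\<close> and \<open>beta_swap\<close> form C1,
  \<open>beta_cyclic\<close> is C2 and \<open>norm_gamma\<close> is C3.\<close>

locale compatible_data = presentation_data W G \<Upsilon> n g q t \<beta> \<gamma>
  for W :: "('w, 'm) monoid_scheme" and G :: "('g, 'k) monoid_scheme" and \<Upsilon> n g q t \<beta> \<gamma> +
  assumes beta_self: "\<And>i. i \<in> {1..n} \<Longrightarrow> \<beta> i i = \<one>\<^bsub>W\<^esub>"
    and beta_swap: "\<And>i j. i \<in> {1..n} \<Longrightarrow> j \<in> {1..n} \<Longrightarrow> \<beta> i j \<otimes>\<^bsub>W\<^esub> \<beta> j i = \<one>\<^bsub>W\<^esub>"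
    and beta_cyclic: "\<And>i j k. i \<in> {1..n} \<Longrightarrow> j \<in> {1..n} \<Longrightarrow> k \<in> {1..n} \<Longrightarrow>
      \<beta> i j \<otimes>\<^bsub>W\<^esub> \<beta> j k \<otimes>\<^bsub>W\<^esub> \<beta> k i =
        \<Upsilon> (g k) (\<beta> i j) \<otimes>\<^bsub>W\<^esub> \<Upsilon> (g i) (\<beta> j k) \<otimes>\<^bsub>W\<^esub> \<Upsilon> (g j) (\<beta> k i)"
    and norm_gamma: "\<And>i j. i \<in> {1..n} \<Longrightarrow> j \<in> {1..n} \<Longrightarrow>
      norm_prod W (\<Upsilon> (g i)) (q i) (\<beta> i j) \<otimes>\<^bsub>W\<^esub> \<gamma> i =
        \<Upsilon> (g j) (\<gamma> i) \<otimes>\<^bsub>W\<^esub> twisted_prod g (t i) (\<lambda>l. \<beta> l j) i"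
begin

lemma beta_inv:
  assumes "i \<in> {1..n}" "j \<in> {1..n}"
  shows "\<beta> j i = inv\<^bsub>W\<^esub> \<beta> i j"
  using W.inv_equality[OF beta_swap[OF assms(2,1)]] assms by simp

text \<open>C2 with \<open>\<beta> j k\<close> written as the inverse of \<open>\<beta> k j\<close>
  and denominators cleared. This is the form in which it appears when \<open>\<tau> i\<close> and
  \<open>\<tau> j\<close> are applied to \<open>x k\<close> in both orders.\<close>

lemma beta_cyclic':
  assumes "i \<in> {1..n}" "j \<in> {1..n}" "k \<in> {1..n}"
  shows "\<beta> i j \<otimes>\<^bsub>W\<^esub> (\<Upsilon> (g i) (\<beta> k j) \<otimes>\<^bsub>W\<^esub> \<beta> k i) =
    \<Upsilon> (g j) (\<beta> k i) \<otimes>\<^bsub>W\<^esub> (\<beta> k j \<otimes>\<^bsub>W\<^esub> \<Upsilon> (g k) (\<beta> i j))"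
proof -
  have "\<beta> i j \<otimes>\<^bsub>W\<^esub> inv\<^bsub>W\<^esub> \<beta> k j \<otimes>\<^bsub>W\<^esub> \<beta> k i =
      \<Upsilon> (g k) (\<beta> i j) \<otimes>\<^bsub>W\<^esub> inv\<^bsub>W\<^esub> \<Upsilon> (g i) (\<beta> k j) \<otimes>\<^bsub>W\<^esub> \<Upsilon> (g j) (\<beta> k i)"
    using beta_cyclic[OF assms] assms beta_inv[of k j] by (simp add: action_inv)
  then have "\<Upsilon> (g i) (\<beta> k j) \<otimes>\<^bsub>W\<^esub> (\<beta> i j \<otimes>\<^bsub>W\<^esub> \<beta> k i) =
      \<beta> k j \<otimes>\<^bsub>W\<^esub> (\<Upsilon> (g k) (\<beta> i j) \<otimes>\<^bsub>W\<^esub> \<Upsilon> (g j) (\<beta> k i))"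
    by (rule W.cross_mult) (use assms in simp_all)
  then show ?thesis using assms by (simp add: W.m_ac)
qed

end

text \<open>With \<open>m = n\<close> this describes an extension inducing the data; smaller
  \<open>m\<close> describes a stage of the construction.\<close>

locale extension_with_data = presentation_data W G \<Upsilon> n g q t \<beta> \<gamma> +
    extension_with_lifts W G \<Upsilon> E \<iota> \<pi> m g x
  for W :: "('w, 'm) monoid_scheme" and G :: "('g, 'k) monoid_scheme" and \<Upsilon> n g q t \<beta> \<gamma>
    and E :: "('e, 'l) monoid_scheme" and \<iota> \<pi> m x +
  assumes m_le: "m \<le> n"
    and x_comm: "\<And>i j. i \<in> {1..m} \<Longrightarrow> j \<in> {1..m} \<Longrightarrow>
      x j \<otimes>\<^bsub>E\<^esub> x i = \<iota> (\<beta> i j) \<otimes>\<^bsub>E\<^esub> x i \<otimes>\<^bsub>E\<^esub> x j"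
    and x_pow: "\<And>i. i \<in> {1..m} \<Longrightarrow>
      x i [^]\<^bsub>E\<^esub> q i = \<iota> (\<gamma> i) \<otimes>\<^bsub>E\<^esub> list_prod E (map (\<lambda>j. x j [^]\<^bsub>E\<^esub> t i j) [1..<i])"
begin

lemma in_n: "k \<in> {1..m} \<Longrightarrow> k \<in> {1..n}"
  using m_le by auto

lemma conj_iota:
  assumes "e \<in> carrier E" "w \<in> carrier W"
  shows "e \<otimes>\<^bsub>E\<^esub> \<iota> w \<otimes>\<^bsub>E\<^esub> inv\<^bsub>E\<^esub> e = \<iota> (\<Upsilon> (\<pi> e) w)"
  using assms by (simp add: iota_swap E.m_assoc)

lemma conj_x:
  assumes "l \<in> {1..m}" "j \<in> {1..m}"
  shows "x j \<otimes>\<^bsub>E\<^esub> x l \<otimes>\<^bsub>E\<^esub> inv\<^bsub>E\<^esub> (x j) = \<iota> (\<beta> l j) \<otimes>\<^bsub>E\<^esub> x l"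
  using assms in_n by (simp add: x_comm[OF assms] x_closed E.m_assoc)

text \<open>\<open>hom_word\<close> for conjugation by \<open>x j\<close>. The index
  \<open>i = Suc m\<close> is allowed, so the lemma also covers the element that is about to receive
  a root.\<close>

lemma conj_word:
  assumes "i \<le> Suc m" "i \<in> {1..n}" "j \<in> {1..m}"
  shows "x j \<otimes>\<^bsub>E\<^esub> (\<iota> (\<gamma> i) \<otimes>\<^bsub>E\<^esub> word (t i) i) \<otimes>\<^bsub>E\<^esub> inv\<^bsub>E\<^esub> (x j) =
    \<iota> (\<Upsilon> (g j) (\<gamma> i) \<otimes>\<^bsub>W\<^esub> twisted_prod g (t i) (\<lambda>l. \<beta> l j) i) \<otimes>\<^bsub>E\<^esub> word (t i) i"
proof (rule hom_word)
  show "(\<lambda>e. x j \<otimes>\<^bsub>E\<^esub> e \<otimes>\<^bsub>E\<^esub> inv\<^bsub>E\<^esub> (x j)) \<in> hom E E"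
    using assms by (intro E.conj_hom x_closed)
  show "\<beta> l j \<in> carrier W" if "l \<in> {1..<i}" for l
    using that assms in_n by (intro beta_in) auto
  show "x j \<otimes>\<^bsub>E\<^esub> x l \<otimes>\<^bsub>E\<^esub> inv\<^bsub>E\<^esub> (x j) = \<iota> (\<beta> l j) \<otimes>\<^bsub>E\<^esub> x l" if "l \<in> {1..<i}" for l
    using that assms by (intro conj_x) auto
qed (use assms in_n in \<open>auto simp: conj_iota x_closed pi_x\<close>)

lemma beta_self_of_extension:
  assumes "i \<in> {1..m}"
  shows "\<beta> i i = \<one>\<^bsub>W\<^esub>"
proof -
  have "\<iota> (\<beta> i i) \<otimes>\<^bsub>E\<^esub> (x i \<otimes>\<^bsub>E\<^esub> x i) = x i \<otimes>\<^bsub>E\<^esub> x i"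
    using x_comm[OF assms assms] assms in_n by (simp add: E.m_assoc x_closed)
  then have "\<iota> (\<beta> i i) = \<iota> \<one>\<^bsub>W\<^esub>"
    using assms in_n by (simp add: E.r_cancel_one x_closed)
  then show ?thesis using assms in_n by (simp add: iota_eq_iff del: iota.hom_one)
qed

text \<open>Interchanging two lifts twice restores their product.\<close>

lemma beta_swap_of_extension:
  assumes "i \<in> {1..m}" "j \<in> {1..m}"
  shows "\<beta> i j \<otimes>\<^bsub>W\<^esub> \<beta> j i = \<one>\<^bsub>W\<^esub>"
proof -
  note c = in_n[OF assms(1)] in_n[OF assms(2)] x_closed[OF assms(1)] x_closed[OF assms(2)]
  have "x j \<otimes>\<^bsub>E\<^esub> x i = \<iota> (\<beta> i j) \<otimes>\<^bsub>E\<^esub> (x i \<otimes>\<^bsub>E\<^esub> x j)"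
    using x_comm[OF assms] c by (simp add: E.m_assoc)
  also have "x i \<otimes>\<^bsub>E\<^esub> x j = \<iota> (\<beta> j i) \<otimes>\<^bsub>E\<^esub> (x j \<otimes>\<^bsub>E\<^esub> x i)"
    using x_comm[OF assms(2,1)] c by (simp add: E.m_assoc)
  also have "\<iota> (\<beta> i j) \<otimes>\<^bsub>E\<^esub> \<dots> = \<iota> (\<beta> i j \<otimes>\<^bsub>W\<^esub> \<beta> j i) \<otimes>\<^bsub>E\<^esub> (x j \<otimes>\<^bsub>E\<^esub> x i)"
    using c by (intro iota_mult_left) auto
  finally have "\<iota> (\<beta> i j \<otimes>\<^bsub>W\<^esub> \<beta> j i) \<otimes>\<^bsub>E\<^esub> (x j \<otimes>\<^bsub>E\<^esub> x i) = x j \<otimes>\<^bsub>E\<^esub> x i" by simp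
  then have "\<iota> (\<beta> i j \<otimes>\<^bsub>W\<^esub> \<beta> j i) = \<iota> \<one>\<^bsub>W\<^esub>"
    using c by (simp add: E.r_cancel_one del: iota.hom_mult)
  then show ?thesis using c by (subst (asm) iota_eq_iff) auto
qed

lemma x_comm_left:
  assumes "i \<in> {1..m}" "j \<in> {1..m}" "f \<in> carrier E"
  shows "x j \<otimes>\<^bsub>E\<^esub> (x i \<otimes>\<^bsub>E\<^esub> f) = \<iota> (\<beta> i j) \<otimes>\<^bsub>E\<^esub> (x i \<otimes>\<^bsub>E\<^esub> (x j \<otimes>\<^bsub>E\<^esub> f))"
  using x_comm[OF assms(1,2)] assms in_n x_closed by (simp add: E.m_assoc[symmetric])

text \<open>Compare the two ways of reversing the product of three lifts.\<close>

lemma beta_cyclic_of_extension: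
  assumes "i \<in> {1..m}" "j \<in> {1..m}" "k \<in> {1..m}"
  shows "\<beta> i j \<otimes>\<^bsub>W\<^esub> \<beta> j k \<otimes>\<^bsub>W\<^esub> \<beta> k i =
    \<Upsilon> (g k) (\<beta> i j) \<otimes>\<^bsub>W\<^esub> \<Upsilon> (g i) (\<beta> j k) \<otimes>\<^bsub>W\<^esub> \<Upsilon> (g j) (\<beta> k i)"
proof -
  note c = in_n[OF assms(1)] in_n[OF assms(2)] in_n[OF assms(3)]
    x_closed[OF assms(1)] x_closed[OF assms(2)] x_closed[OF assms(3)]
  note p = pi_x[OF assms(1)] pi_x[OF assms(2)] pi_x[OF assms(3)]
  let ?X = "x i \<otimes>\<^bsub>E\<^esub> (x j \<otimes>\<^bsub>E\<^esub> x k)"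
  have comm2: "x a \<otimes>\<^bsub>E\<^esub> x b = \<iota> (\<beta> b a) \<otimes>\<^bsub>E\<^esub> (x b \<otimes>\<^bsub>E\<^esub> x a)" if "a \<in> {1..m}" "b \<in> {1..m}" for a b
    using x_comm[OF that(2,1)] that in_n x_closed by (simp add: E.m_assoc)
  \<comment> \<open>Interchange \<open>j\<close> with \<open>i\<close>, then \<open>k\<close> with
    \<open>i\<close>, then \<open>k\<close> with \<open>j\<close>.\<close>
  have 1: "x k \<otimes>\<^bsub>E\<^esub> (x j \<otimes>\<^bsub>E\<^esub> x i) =
      \<iota> (\<Upsilon> (g k) (\<beta> i j) \<otimes>\<^bsub>W\<^esub> (\<beta> i k \<otimes>\<^bsub>W\<^esub> \<Upsilon> (g i) (\<beta> j k))) \<otimes>\<^bsub>E\<^esub> ?X"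
  proof -
    have "x k \<otimes>\<^bsub>E\<^esub> (x j \<otimes>\<^bsub>E\<^esub> x i) = \<iota> (\<Upsilon> (g k) (\<beta> i j)) \<otimes>\<^bsub>E\<^esub> (x k \<otimes>\<^bsub>E\<^esub> (x i \<otimes>\<^bsub>E\<^esub> x j))"
      using c p assms by (simp add: comm2[of j i] iota_swap_left)
    also have "x k \<otimes>\<^bsub>E\<^esub> (x i \<otimes>\<^bsub>E\<^esub> x j) = \<iota> (\<beta> i k) \<otimes>\<^bsub>E\<^esub> (x i \<otimes>\<^bsub>E\<^esub> (x k \<otimes>\<^bsub>E\<^esub> x j))"
      using c assms by (intro x_comm_left) auto
    also have "x i \<otimes>\<^bsub>E\<^esub> (x k \<otimes>\<^bsub>E\<^esub> x j) = \<iota> (\<Upsilon> (g i) (\<beta> j k)) \<otimes>\<^bsub>E\<^esub> ?X"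
      using c p assms by (simp add: comm2[of k j] iota_swap_left)
    finally show ?thesis using c by (simp add: E.m_assoc)
  qed
  \<comment> \<open>Interchange \<open>k\<close> with \<open>j\<close>, then \<open>k\<close> with
    \<open>i\<close>, then \<open>j\<close> with \<open>i\<close>.\<close>
  have 2: "x k \<otimes>\<^bsub>E\<^esub> (x j \<otimes>\<^bsub>E\<^esub> x i) =
      \<iota> (\<beta> j k \<otimes>\<^bsub>W\<^esub> (\<Upsilon> (g j) (\<beta> i k) \<otimes>\<^bsub>W\<^esub> \<beta> i j)) \<otimes>\<^bsub>E\<^esub> ?X"
  proof -
    have "x k \<otimes>\<^bsub>E\<^esub> (x j \<otimes>\<^bsub>E\<^esub> x i) = \<iota> (\<beta> j k) \<otimes>\<^bsub>E\<^esub> (x j \<otimes>\<^bsub>E\<^esub> (x k \<otimes>\<^bsub>E\<^esub> x i))"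
      using c assms by (intro x_comm_left) auto
    also have "x j \<otimes>\<^bsub>E\<^esub> (x k \<otimes>\<^bsub>E\<^esub> x i) = \<iota> (\<Upsilon> (g j) (\<beta> i k)) \<otimes>\<^bsub>E\<^esub> (x j \<otimes>\<^bsub>E\<^esub> (x i \<otimes>\<^bsub>E\<^esub> x k))"
      using c p assms by (simp add: comm2[of k i] iota_swap_left)
    also have "x j \<otimes>\<^bsub>E\<^esub> (x i \<otimes>\<^bsub>E\<^esub> x k) = \<iota> (\<beta> i j) \<otimes>\<^bsub>E\<^esub> ?X"
      using c assms by (intro x_comm_left) auto
    finally show ?thesis using c by (simp add: E.m_assoc)
  qed
  have "\<iota> (\<Upsilon> (g k) (\<beta> i j) \<otimes>\<^bsub>W\<^esub> (\<beta> i k \<otimes>\<^bsub>W\<^esub> \<Upsilon> (g i) (\<beta> j k))) =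
      \<iota> (\<beta> j k \<otimes>\<^bsub>W\<^esub> (\<Upsilon> (g j) (\<beta> i k) \<otimes>\<^bsub>W\<^esub> \<beta> i j))"
    using 1 2 c by (simp del: iota.hom_mult)
  then have eq: "\<Upsilon> (g k) (\<beta> i j) \<otimes>\<^bsub>W\<^esub> (\<beta> i k \<otimes>\<^bsub>W\<^esub> \<Upsilon> (g i) (\<beta> j k)) =
      \<beta> j k \<otimes>\<^bsub>W\<^esub> (\<Upsilon> (g j) (\<beta> i k) \<otimes>\<^bsub>W\<^esub> \<beta> i j)"
    using c by (subst (asm) iota_eq_iff) auto
  \<comment> \<open>Both computations produce \<open>\<beta> i k\<close>, whereas the cyclic form of
    C2 contains its inverse \<open>\<beta> k i\<close>.\<close>
  have ki: "\<beta> i k = inv\<^bsub>W\<^esub> \<beta> k i"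
    using W.inv_equality[OF beta_swap_of_extension[OF assms(1,3)]] c by simp
  have "\<Upsilon> (g k) (\<beta> i j) \<otimes>\<^bsub>W\<^esub> inv\<^bsub>W\<^esub> \<beta> k i \<otimes>\<^bsub>W\<^esub> \<Upsilon> (g i) (\<beta> j k) =
      \<beta> j k \<otimes>\<^bsub>W\<^esub> inv\<^bsub>W\<^esub> \<Upsilon> (g j) (\<beta> k i) \<otimes>\<^bsub>W\<^esub> \<beta> i j"
    using eq c by (simp add: ki action_inv W.m_assoc)
  then have "\<Upsilon> (g j) (\<beta> k i) \<otimes>\<^bsub>W\<^esub> (\<Upsilon> (g k) (\<beta> i j) \<otimes>\<^bsub>W\<^esub> \<Upsilon> (g i) (\<beta> j k)) =
      \<beta> k i \<otimes>\<^bsub>W\<^esub> (\<beta> j k \<otimes>\<^bsub>W\<^esub> \<beta> i j)"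
    by (rule W.cross_mult) (use c in simp_all)
  then show ?thesis using c by (simp add: W.m_ac)
qed

text \<open>Conjugation by \<open>x j\<close> sends \<open>x i\<close> to a multiple by
  \<open>\<beta> i j\<close>, whose power yields the norm on the left of C3;
  \<open>conj_word\<close> evaluates the other side of the power relation.\<close>

lemma norm_gamma_of_extension:
  assumes "i \<in> {1..m}" "j \<in> {1..m}"
  shows "norm_prod W (\<Upsilon> (g i)) (q i) (\<beta> i j) \<otimes>\<^bsub>W\<^esub> \<gamma> i =
    \<Upsilon> (g j) (\<gamma> i) \<otimes>\<^bsub>W\<^esub> twisted_prod g (t i) (\<lambda>l. \<beta> l j) i"
proof -
  note c = in_n[OF assms(1)] in_n[OF assms(2)] x_closed[OF assms(1)] x_closed[OF assms(2)]
  have pow: "x i [^]\<^bsub>E\<^esub> q i = \<iota> (\<gamma> i) \<otimes>\<^bsub>E\<^esub> word (t i) i"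
    using x_pow[OF assms(1)] by (simp add: word_def)
  have wc: "word (t i) i \<in> carrier E" using assms by (intro word_closed) auto
  interpret h: group_hom E E "\<lambda>e. x j \<otimes>\<^bsub>E\<^esub> e \<otimes>\<^bsub>E\<^esub> inv\<^bsub>E\<^esub> (x j)"
    by (intro group_hom.intro group_hom_axioms.intro E.conj_hom c E.is_group)
  have N: "norm_prod W (\<Upsilon> (g i)) (q i) (\<beta> i j) \<in> carrier W" using c by simp
  have P: "twisted_prod g (t i) (\<lambda>l. \<beta> l j) i \<in> carrier W"
    using assms in_n by (intro twisted_prod_closed g_in beta_in) auto
  have "x j \<otimes>\<^bsub>E\<^esub> x i [^]\<^bsub>E\<^esub> q i \<otimes>\<^bsub>E\<^esub> inv\<^bsub>E\<^esub> (x j) = (\<iota> (\<beta> i j) \<otimes>\<^bsub>E\<^esub> x i) [^]\<^bsub>E\<^esub> q i"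
    using h.hom_nat_pow[OF c(3)] conj_x[OF assms] by simp
  also have "\<dots> = \<iota> (norm_prod W (\<Upsilon> (g i)) (q i) (\<beta> i j)) \<otimes>\<^bsub>E\<^esub> (\<iota> (\<gamma> i) \<otimes>\<^bsub>E\<^esub> word (t i) i)"
    using c by (simp only: pow_iota_mult beta_in pi_x[OF assms(1)] pow)
  also have "\<dots> = \<iota> (norm_prod W (\<Upsilon> (g i)) (q i) (\<beta> i j) \<otimes>\<^bsub>W\<^esub> \<gamma> i) \<otimes>\<^bsub>E\<^esub> word (t i) i"
    using c N wc by (intro iota_mult_left) auto
  finally have "\<iota> (norm_prod W (\<Upsilon> (g i)) (q i) (\<beta> i j) \<otimes>\<^bsub>W\<^esub> \<gamma> i) \<otimes>\<^bsub>E\<^esub> word (t i) i =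
      \<iota> (\<Upsilon> (g j) (\<gamma> i) \<otimes>\<^bsub>W\<^esub> twisted_prod g (t i) (\<lambda>l. \<beta> l j) i) \<otimes>\<^bsub>E\<^esub> word (t i) i"
    using conj_word[of i j] assms c(1) by (simp add: pow)
  then have "\<iota> (norm_prod W (\<Upsilon> (g i)) (q i) (\<beta> i j) \<otimes>\<^bsub>W\<^esub> \<gamma> i) =
      \<iota> (\<Upsilon> (g j) (\<gamma> i) \<otimes>\<^bsub>W\<^esub> twisted_prod g (t i) (\<lambda>l. \<beta> l j) i)"
    using c N P wc by (simp del: iota.hom_mult)
  then show ?thesis using c N P by (subst (asm) iota_eq_iff) auto
qed

end

section \<open>Necessity of the conditions\<close>

lemma induces_data_conditions:
  fixes W :: "('w, 'm) monoid_scheme" and G :: "('g, 'k) monoid_scheme"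
  assumes "presentation_data W G \<Upsilon> n g \<beta> \<gamma>" and "induces_data W G \<Upsilon> n g q t \<beta> \<gamma> \<alpha>"
  shows "compatible_data W G \<Upsilon> n g q t \<beta> \<gamma>"
proof -
  interpret presentation_data W G \<Upsilon> n g q t \<beta> \<gamma> by (rule assms(1))
  obtain E :: "('w \<times> 'g) monoid" and \<iota> \<pi> u where ext: "epi_with_kernel W G E \<iota> \<pi>"
    and act: "induces_action W G \<Upsilon> E \<iota> \<pi>" and sec: "crossed_section G E \<pi> u"
    and dat: "section_has_data n g q t \<beta> \<gamma> E \<iota> u"
    using assms(2) unfolding induces_data_def induces_data_via_def by blast
  interpret E: group E using ext by (simp add: epi_with_kernel_def)
  \<comment> \<open>The values of the section at the generators serve as lifts, with
    \<open>m = n\<close>.\<close>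
  interpret ext: extension_with_data W G \<Upsilon> n g q t \<beta> \<gamma> E \<iota> \<pi> n "\<lambda>k. u (g k)"
  proof
    show "\<iota> \<in> hom W E" "inj_on \<iota> (carrier W)" "\<pi> \<in> hom E G" "kernel E G \<pi> = \<iota> ` carrier W"
      using ext by (auto simp: epi_with_kernel_def epi_def mon_def)
    then have io: "\<iota> w \<in> carrier E" if "w \<in> carrier W" for w using that by (auto simp: hom_def)
    fix e w assume e: "e \<in> carrier E" and w: "w \<in> carrier W"
    have pe: "\<pi> e \<in> carrier G" using \<open>\<pi> \<in> hom E G\<close> e by (auto simp: hom_def)
    have "e \<otimes>\<^bsub>E\<^esub> \<iota> w \<otimes>\<^bsub>E\<^esub> inv\<^bsub>E\<^esub> e = \<iota> (\<Upsilon> (\<pi> e) w)"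
      using act e w pe by (simp add: induces_action_def)
    then have "e \<otimes>\<^bsub>E\<^esub> \<iota> w \<otimes>\<^bsub>E\<^esub> inv\<^bsub>E\<^esub> e \<otimes>\<^bsub>E\<^esub> e = \<iota> (\<Upsilon> (\<pi> e) w) \<otimes>\<^bsub>E\<^esub> e" by simp
    then show "e \<otimes>\<^bsub>E\<^esub> \<iota> w = \<iota> (\<Upsilon> (\<pi> e) w) \<otimes>\<^bsub>E\<^esub> e"
      using e io[OF w] by (simp add: E.m_assoc)
  next
    show "u (g k) \<in> carrier E" "\<pi> (u (g k)) = g k" if "k \<in> {1..n}" for k
      using sec g_in[OF that] by (auto simp: crossed_section_def)
    show "u (g j) \<otimes>\<^bsub>E\<^esub> u (g i) = \<iota> (\<beta> i j) \<otimes>\<^bsub>E\<^esub> u (g i) \<otimes>\<^bsub>E\<^esub> u (g j)"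
      if "i \<in> {1..n}" "j \<in> {1..n}" for i j
      using dat that by (simp add: section_has_data_def)
    show "u (g i) [^]\<^bsub>E\<^esub> q i =
        \<iota> (\<gamma> i) \<otimes>\<^bsub>E\<^esub> list_prod E (map (\<lambda>j. u (g j) [^]\<^bsub>E\<^esub> t i j) [1..<i])"
      if "i \<in> {1..n}" for i
      using dat that by (simp add: section_has_data_def)
  qed simp
  show ?thesis
    by unfold_locales (rule ext.beta_self_of_extension ext.beta_swap_of_extension
        ext.beta_cyclic_of_extension ext.norm_gamma_of_extension; assumption)+
qed

section \<open>Adjoining the generators one by one\<close>

text \<open>\<open>\<tau> j\<close> is conjugation by the lift of \<open>g j\<close>, defined for every \<open>j \<le> n\<close> although only the lifts
  with \<open>j \<le> m\<close> already exist in \<open>E\<close>.\<close>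

locale partial_extension = compatible_data W G \<Upsilon> n g q t \<beta> \<gamma> +
    extension_with_data W G \<Upsilon> n g q t \<beta> \<gamma> E \<iota> \<pi> m x
  for W :: "('w, 'm) monoid_scheme" and G :: "('g, 'k) monoid_scheme" and \<Upsilon> n g q t \<beta> \<gamma>
    and E :: "('e, 'l) monoid_scheme" and \<iota> \<pi> m x +
  fixes \<tau> :: "nat \<Rightarrow> 'e \<Rightarrow> 'e"
  assumes generated: "carrier E = generate E (\<iota> ` carrier W \<union> x ` {1..m})"
    and tau_hom: "\<And>j. j \<in> {1..n} \<Longrightarrow> \<tau> j \<in> hom E E"
    and tau_iota: "\<And>j w. j \<in> {1..n} \<Longrightarrow> w \<in> carrier W \<Longrightarrow> \<tau> j (\<iota> w) = \<iota> (\<Upsilon> (g j) w)"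
    and tau_x: "\<And>j k. j \<in> {1..n} \<Longrightarrow> k \<in> {1..m} \<Longrightarrow> \<tau> j (x k) = \<iota> (\<beta> k j) \<otimes>\<^bsub>E\<^esub> x k"
begin

lemma generators_closed: "\<iota> ` carrier W \<union> x ` {1..m} \<subseteq> carrier E"
  using x_closed by auto

text \<open>\<open>W\<close> and the lifts generate \<open>E\<close>, so the identities below are
  checked on these only.\<close>

lemma hom_eqI:
  assumes "group F" "h \<in> hom E F" "k \<in> hom E F" "e \<in> carrier E"
    and "\<And>w. w \<in> carrier W \<Longrightarrow> h (\<iota> w) = k (\<iota> w)"
    and "\<And>l. l \<in> {1..m} \<Longrightarrow> h (x l) = k (x l)"
  shows "h e = k e"
proof -
  interpret h: group_hom E F h
    by (intro group_hom.intro group_hom_axioms.intro assms E.is_group)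
  show ?thesis
  proof (rule h.hom_eq_on_generate[OF assms(3) generators_closed])
    show "h s = k s" if "s \<in> \<iota> ` carrier W \<union> x ` {1..m}" for s
      using that assms by auto
    show "e \<in> generate E (\<iota> ` carrier W \<union> x ` {1..m})"
      using assms generated by blast
  qed
qed

lemma tau_closed: "j \<in> {1..n} \<Longrightarrow> e \<in> carrier E \<Longrightarrow> \<tau> j e \<in> carrier E"
  using tau_hom by (auto simp: hom_def)

lemma tau_mult:
  "j \<in> {1..n} \<Longrightarrow> e \<in> carrier E \<Longrightarrow> f \<in> carrier E \<Longrightarrow> \<tau> j (e \<otimes>\<^bsub>E\<^esub> f) = \<tau> j e \<otimes>\<^bsub>E\<^esub> \<tau> j f"
  using tau_hom by (auto simp: hom_def)

lemma tau_pow_hom: "j \<in> {1..n} \<Longrightarrow> \<tau> j ^^ s \<in> hom E E"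
  by (induction s) (auto simp: hom_def tau_closed tau_mult Pi_iff)

lemma tau_pow_iota:
  assumes "j \<in> {1..n}" "w \<in> carrier W"
  shows "(\<tau> j ^^ s) (\<iota> w) = \<iota> (\<Upsilon> (g j [^]\<^bsub>G\<^esub> s) w)"
proof -
  have "(\<tau> j ^^ s) (\<iota> w) = \<iota> ((\<Upsilon> (g j) ^^ s) w)"
    by (induction s) (use assms in \<open>auto simp: tau_iota action_funpow\<close>)
  then show ?thesis using assms by (simp add: action_funpow)
qed

lemma tau_pow_x:
  assumes "j \<in> {1..n}" "k \<in> {1..m}"
  shows "(\<tau> j ^^ s) (x k) = \<iota> (norm_prod W (\<Upsilon> (g j)) s (\<beta> k j)) \<otimes>\<^bsub>E\<^esub> x k"
proof (induction s)
  case (Suc s)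
  note c = assms(1) in_n[OF assms(2)] x_closed[OF assms(2)]
  \<comment> \<open>Expanding the innermost application splits off the last factor of the
    norm.\<close>
  have "(\<tau> j ^^ Suc s) (x k) = (\<tau> j ^^ s) (\<iota> (\<beta> k j) \<otimes>\<^bsub>E\<^esub> x k)"
    using assms by (simp add: funpow_swap1 tau_x)
  also have "\<dots> = (\<tau> j ^^ s) (\<iota> (\<beta> k j)) \<otimes>\<^bsub>E\<^esub> (\<tau> j ^^ s) (x k)"
    using c tau_pow_hom[OF c(1), of s] by (simp add: hom_def)
  also have "\<dots> = \<iota> (\<Upsilon> (g j [^]\<^bsub>G\<^esub> s) (\<beta> k j) \<otimes>\<^bsub>W\<^esub> norm_prod W (\<Upsilon> (g j)) s (\<beta> k j)) \<otimes>\<^bsub>E\<^esub> x k"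
    unfolding Suc using c by (subst iota_mult_left[symmetric]) (simp_all add: tau_pow_iota)
  finally show ?case using c by (simp only: norm_prod_Suc g_in beta_in W.m_comm
        action_closed G.nat_pow_closed norm_prod_closed)
qed (use assms x_closed in simp)

text \<open>\<open>\<tau> j\<close> changes lifts only by elements of \<open>W\<close>. Since
  \<open>G\<close> is commutative, this is what lets \<open>\<pi>\<close> extend by
  \<open>y \<mapsto> g i\<close>.\<close>

lemma pi_tau:
  assumes "j \<in> {1..n}" "e \<in> carrier E"
  shows "\<pi> (\<tau> j e) = \<pi> e"
proof -
  have "(\<pi> \<circ> \<tau> j) e = \<pi> e"
  proof (rule hom_eqI[OF G.is_group _ pi_hom])
    show "\<pi> \<circ> \<tau> j \<in> hom E G" by (rule hom_compose[OF tau_hom[OF assms(1)] pi_hom])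
  qed (use assms in_n x_closed in \<open>simp_all add: tau_iota tau_x\<close>)
  then show ?thesis by simp
qed

text \<open>Conjugations by lifts must satisfy this, because the lifts commute up to
  \<open>\<beta> i j\<close>. Here it is checked on generators: on \<open>W\<close> it follows from
  commutativity of \<open>G\<close> and \<open>W\<close>, on \<open>x k\<close> it is C2.\<close>

lemma tau_comm:
  assumes "i \<in> {1..n}" "j \<in> {1..n}" "e \<in> carrier E"
  shows "\<iota> (\<beta> i j) \<otimes>\<^bsub>E\<^esub> \<tau> i (\<tau> j e) = \<tau> j (\<tau> i e) \<otimes>\<^bsub>E\<^esub> \<iota> (\<beta> i j)"
proof -
  let ?b = "\<iota> (\<beta> i j)"
  have bc: "?b \<in> carrier E" "\<beta> i j \<in> carrier W" using assms by auto
  let ?h = "(\<lambda>e. ?b \<otimes>\<^bsub>E\<^esub> e \<otimes>\<^bsub>E\<^esub> inv\<^bsub>E\<^esub> ?b) \<circ> (\<tau> i \<circ> \<tau> j)"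
  have h: "?h \<in> hom E E"
    by (rule hom_compose[OF hom_compose[OF tau_hom[OF assms(2)] tau_hom[OF assms(1)]] E.conj_hom[OF bc(1)]])
  have k: "\<tau> j \<circ> \<tau> i \<in> hom E E"
    by (rule hom_compose[OF tau_hom[OF assms(1)] tau_hom[OF assms(2)]])
  have "?h e = (\<tau> j \<circ> \<tau> i) e"
  proof (rule hom_eqI[OF E.is_group h k assms(3)])
    fix w assume w: "w \<in> carrier W"
    have "\<Upsilon> (g i) (\<Upsilon> (g j) w) = \<Upsilon> (g j) (\<Upsilon> (g i) w)"
      using assms w by (simp add: action_comp[symmetric] G.m_comm)
    then show "?h (\<iota> w) = (\<tau> j \<circ> \<tau> i) (\<iota> w)"
      using assms w bc by (simp add: tau_iota conj_iota)
  next
    fix k assume k: "k \<in> {1..m}"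
    note c = assms(1,2) in_n[OF k] x_closed[OF k] bc
    have "?b \<otimes>\<^bsub>E\<^esub> \<tau> i (\<tau> j (x k)) =
        \<iota> (\<beta> i j \<otimes>\<^bsub>W\<^esub> (\<Upsilon> (g i) (\<beta> k j) \<otimes>\<^bsub>W\<^esub> \<beta> k i)) \<otimes>\<^bsub>E\<^esub> x k"
      using c k by (simp add: tau_x tau_mult tau_iota E.m_assoc)
    also have "\<dots> = \<iota> (\<Upsilon> (g j) (\<beta> k i) \<otimes>\<^bsub>W\<^esub> (\<beta> k j \<otimes>\<^bsub>W\<^esub> \<Upsilon> (g k) (\<beta> i j))) \<otimes>\<^bsub>E\<^esub> x k"
      using c by (simp only: beta_cyclic')
    also have "\<dots> = \<iota> (\<Upsilon> (g j) (\<beta> k i)) \<otimes>\<^bsub>E\<^esub> (\<iota> (\<beta> k j) \<otimes>\<^bsub>E\<^esub> (x k \<otimes>\<^bsub>E\<^esub> ?b))"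
      using c k by (simp add: iota_swap[OF c(4) c(6)] pi_x E.m_assoc)
    also have "\<dots> = \<tau> j (\<tau> i (x k)) \<otimes>\<^bsub>E\<^esub> ?b"
      using c k by (simp add: tau_x tau_mult tau_iota E.m_assoc)
    finally show "?h (x k) = (\<tau> j \<circ> \<tau> i) (x k)"
      using c by (simp add: tau_closed E.m_assoc)
  qed
  then have "?b \<otimes>\<^bsub>E\<^esub> \<tau> i (\<tau> j e) \<otimes>\<^bsub>E\<^esub> inv\<^bsub>E\<^esub> ?b \<otimes>\<^bsub>E\<^esub> ?b = \<tau> j (\<tau> i e) \<otimes>\<^bsub>E\<^esub> ?b" by simp
  then show ?thesis using assms bc by (simp add: E.m_assoc tau_closed)
qed

text \<open>C3 in terms of the future power of \<open>x i\<close>. For \<open>j = i\<close> the norm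
  is trivial and the element is fixed by \<open>\<tau> i\<close>; for general \<open>j\<close> it is
  the power relation needed to send \<open>y\<close> to its multiple by
  \<open>\<beta> i j\<close>.\<close>

lemma tau_root:
  assumes "i = Suc m" "i \<in> {1..n}" "j \<in> {1..n}"
  shows "\<tau> j (\<iota> (\<gamma> i) \<otimes>\<^bsub>E\<^esub> word (t i) i) =
    \<iota> (norm_prod W (\<Upsilon> (g i)) (q i) (\<beta> i j)) \<otimes>\<^bsub>E\<^esub> (\<iota> (\<gamma> i) \<otimes>\<^bsub>E\<^esub> word (t i) i)"
proof -
  have wc: "word (t i) i \<in> carrier E" using assms by (intro word_closed) auto
  have "\<tau> j (\<iota> (\<gamma> i) \<otimes>\<^bsub>E\<^esub> word (t i) i) =
      \<iota> (\<Upsilon> (g j) (\<gamma> i) \<otimes>\<^bsub>W\<^esub> twisted_prod g (t i) (\<lambda>l. \<beta> l j) i) \<otimes>\<^bsub>E\<^esub> word (t i) i"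
    using assms by (intro hom_word tau_hom) (auto simp: tau_iota tau_x)
  also have "\<dots> = \<iota> (norm_prod W (\<Upsilon> (g i)) (q i) (\<beta> i j)) \<otimes>\<^bsub>E\<^esub> (\<iota> (\<gamma> i) \<otimes>\<^bsub>E\<^esub> word (t i) i)"
    using assms wc by (subst iota_mult_left) (simp_all only: norm_gamma gamma_in norm_prod_closed g_in beta_in)
  finally show ?thesis .
qed

text \<open>On \<open>W\<close> both sides act through \<open>g i [^] q i\<close>, by
  \<open>rel\<close>. On \<open>x k\<close>, C3 computes the conjugate of \<open>c\<close> by
  \<open>x k\<close>, and solving for the conjugate of \<open>x k\<close> by \<open>c\<close> gives
  the norm found in \<open>tau_pow_x\<close>.\<close>

lemma tau_pow_eq_conj:
  assumes i: "i = Suc m" "i \<in> {1..n}" and "e \<in> carrier E"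
    and rel: "g i [^]\<^bsub>G\<^esub> q i = finprod G (\<lambda>j. g j [^]\<^bsub>G\<^esub> t i j) {1..<i}"
  defines "c \<equiv> \<iota> (\<gamma> i) \<otimes>\<^bsub>E\<^esub> word (t i) i"
  shows "c \<otimes>\<^bsub>E\<^esub> e = (\<tau> i ^^ q i) e \<otimes>\<^bsub>E\<^esub> c"
proof -
  have wc: "word (t i) i \<in> carrier E" using i by (intro word_closed) auto
  then have c: "c \<in> carrier E" using i by (simp add: c_def)
  have pc: "\<pi> c = g i [^]\<^bsub>G\<^esub> q i"
    using i wc rel by (simp add: c_def pi_word)
  have "c \<otimes>\<^bsub>E\<^esub> e \<otimes>\<^bsub>E\<^esub> inv\<^bsub>E\<^esub> c = (\<tau> i ^^ q i) e"
  proof (rule hom_eqI[OF E.is_group E.conj_hom[OF c] tau_pow_hom[OF i(2)] assms(3)])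
    fix w assume "w \<in> carrier W"
    then show "c \<otimes>\<^bsub>E\<^esub> \<iota> w \<otimes>\<^bsub>E\<^esub> inv\<^bsub>E\<^esub> c = (\<tau> i ^^ q i) (\<iota> w)"
      using i c by (simp add: conj_iota pc tau_pow_iota)
  next
    fix k assume k: "k \<in> {1..m}"
    note cl = i(2) in_n[OF k] x_closed[OF k] c wc
    let ?N = "\<lambda>b. norm_prod W (\<Upsilon> (g i)) (q i) b"
    have Nc: "?N (\<beta> i k) \<in> carrier W" using cl by simp
    \<comment> \<open>C1 accounts for the inverse that appears when the roles of \<open>c\<close>
      and \<open>x k\<close> are exchanged.\<close>
    have Ninv: "?N (\<beta> k i) = inv\<^bsub>W\<^esub> ?N (\<beta> i k)"
      using cl by (simp add: beta_inv[of i k] norm_prod_inv)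
    have "x k \<otimes>\<^bsub>E\<^esub> c \<otimes>\<^bsub>E\<^esub> inv\<^bsub>E\<^esub> (x k) = \<iota> (?N (\<beta> i k)) \<otimes>\<^bsub>E\<^esub> c"
    proof -
      have "x k \<otimes>\<^bsub>E\<^esub> c \<otimes>\<^bsub>E\<^esub> inv\<^bsub>E\<^esub> (x k) = \<iota> (?N (\<beta> i k) \<otimes>\<^bsub>W\<^esub> \<gamma> i) \<otimes>\<^bsub>E\<^esub> word (t i) i"
        unfolding c_def using i k cl by (subst conj_word) (simp_all only: norm_gamma order_refl)
      then show ?thesis using cl Nc by (simp add: c_def E.m_assoc)
    qed
    then have "x k \<otimes>\<^bsub>E\<^esub> c \<otimes>\<^bsub>E\<^esub> inv\<^bsub>E\<^esub> (x k) \<otimes>\<^bsub>E\<^esub> x k = \<iota> (?N (\<beta> i k)) \<otimes>\<^bsub>E\<^esub> c \<otimes>\<^bsub>E\<^esub> x k" by simp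
    then have "x k \<otimes>\<^bsub>E\<^esub> c = \<iota> (?N (\<beta> i k)) \<otimes>\<^bsub>E\<^esub> (c \<otimes>\<^bsub>E\<^esub> x k)"
      using cl Nc by (simp add: E.m_assoc)
    then have "\<iota> (?N (\<beta> k i)) \<otimes>\<^bsub>E\<^esub> (x k \<otimes>\<^bsub>E\<^esub> c) = c \<otimes>\<^bsub>E\<^esub> x k"
      using cl Nc by (simp add: Ninv iota_mult_left del: iota.hom_mult iota.hom_inv)
    then have "\<iota> (?N (\<beta> k i)) \<otimes>\<^bsub>E\<^esub> (x k \<otimes>\<^bsub>E\<^esub> c) \<otimes>\<^bsub>E\<^esub> inv\<^bsub>E\<^esub> c = c \<otimes>\<^bsub>E\<^esub> x k \<otimes>\<^bsub>E\<^esub> inv\<^bsub>E\<^esub> c"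
      by (rule arg_cong)
    then have "\<iota> (?N (\<beta> k i)) \<otimes>\<^bsub>E\<^esub> x k = c \<otimes>\<^bsub>E\<^esub> x k \<otimes>\<^bsub>E\<^esub> inv\<^bsub>E\<^esub> c"
      using cl by (simp add: E.m_assoc)
    then show "c \<otimes>\<^bsub>E\<^esub> x k \<otimes>\<^bsub>E\<^esub> inv\<^bsub>E\<^esub> c = (\<tau> i ^^ q i) (x k)"
      using i k by (simp only: tau_pow_x)
  qed
  then have "c \<otimes>\<^bsub>E\<^esub> e \<otimes>\<^bsub>E\<^esub> inv\<^bsub>E\<^esub> c \<otimes>\<^bsub>E\<^esub> c = (\<tau> i ^^ q i) e \<otimes>\<^bsub>E\<^esub> c" by simp
  then show ?thesis using assms(3) c by (simp add: E.m_assoc)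
qed

lemma pi_in_generate:
  assumes "e \<in> carrier E"
  shows "\<pi> e \<in> generate G (g ` {1..m})"
proof -
  have sub: "g ` {1..m} \<subseteq> carrier G" using g_closed by auto
  have "\<pi> e \<in> \<pi> ` generate E (\<iota> ` carrier W \<union> x ` {1..m})"
    using assms generated by blast
  also have "\<dots> = generate G (\<pi> ` (\<iota> ` carrier W \<union> x ` {1..m}))"
    by (rule pi.generate_img[OF generators_closed, symmetric])
  also have "\<dots> \<subseteq> generate G (g ` {1..m})"
    by (rule G.generate_subgroup_incl[OF _ G.generate_is_subgroup[OF sub]])
      (auto simp: pi_x intro: generate.one generate.incl)
  finally show ?thesis .
qed

text \<open>The induction step. Each property of the new stage is transported along
  \<open>\<kappa>\<close> or checked at \<open>y\<close>; the hypothesis \<open>order\<close> keeps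
  the kernel from growing beyond \<open>W\<close>.\<close>

lemma adjoin:
  fixes enc :: "'e \<times> nat \<Rightarrow> 'f"
  assumes "inj enc" and i: "i = Suc m" "i \<in> {1..n}" and "0 < q i"
    and order: "\<And>a. a < q i \<Longrightarrow> g i [^]\<^bsub>G\<^esub> a \<in> generate G (g ` {1..m}) \<Longrightarrow> a = 0"
    and rel: "g i [^]\<^bsub>G\<^esub> q i = finprod G (\<lambda>j. g j [^]\<^bsub>G\<^esub> t i j) {1..<i}"
  shows "\<exists>(E' :: 'f monoid) \<iota>' \<pi>' x' \<tau>'.
    partial_extension W G \<Upsilon> n g q t \<beta> \<gamma> E' \<iota>' \<pi>' i x' \<tau>'"
proof -
  define c where "c = \<iota> (\<gamma> i) \<otimes>\<^bsub>E\<^esub> word (t i) i"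
  have wc: "word (t i) i \<in> carrier E" using i by (intro word_closed) auto
  then have c: "c \<in> carrier E" using i by (simp add: c_def)
  have pc: "\<pi> c = g i [^]\<^bsub>G\<^esub> q i"
    using i wc rel by (simp add: c_def pi_word)
  have "\<tau> i c = c"
    using tau_root[OF i i(2), folded c_def] c
    by (simp only: beta_self[OF i(2)] norm_prod_W_one[OF g_in[OF i(2)]] iota.hom_one E.l_one)
  moreover have "c \<otimes>\<^bsub>E\<^esub> e = (\<tau> i ^^ q i) e \<otimes>\<^bsub>E\<^esub> c" if "e \<in> carrier E" for e
    unfolding c_def by (rule tau_pow_eq_conj[OF i that rel])
  ultimately obtain E' :: "'f monoid" and \<kappa> y where "cyclic_extension E E' (\<tau> i) c (q i) \<kappa> y"
    using cyclic_extension_exists[OF E.is_group assms(1) tau_hom[OF i(2)] c _ \<open>0 < q i\<close>] by blast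
  then interpret cyc: cyclic_extension E E' "\<tau> i" c "q i" \<kappa> y .
  define \<iota>' where "\<iota>' = \<kappa> \<circ> \<iota>"
  define x' where "x' k = (if k = i then y else \<kappa> (x k))" for k
  \<comment> \<open>The swap rule holds by \<open>pi_tau\<close>, the power relation by
    \<open>rel\<close>.\<close>
  have "\<exists>\<pi>'\<in>hom E' G. (\<forall>e\<in>carrier E. \<pi>' (\<kappa> e) = \<pi> e) \<and> \<pi>' y = g i"
    using i by (intro cyc.extend_hom G.is_group pi_hom) (auto simp: pc pi_tau G.m_comm)
  then obtain \<pi>' where pi': "\<pi>' \<in> hom E' G" "\<And>e. e \<in> carrier E \<Longrightarrow> \<pi>' (\<kappa> e) = \<pi> e" "\<pi>' y = g i"
    by blast
  interpret pi': group_hom E' G \<pi>'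
    by (intro group_hom.intro group_hom_axioms.intro pi' G.is_group cyc.E.is_group)
  have pi'_nf: "\<pi>' (\<kappa> e \<otimes>\<^bsub>E'\<^esub> y [^]\<^bsub>E'\<^esub> a) = \<pi> e \<otimes>\<^bsub>G\<^esub> g i [^]\<^bsub>G\<^esub> a" if "e \<in> carrier E" for e and a :: nat
    using that by (simp add: pi' pi'.hom_nat_pow)
  interpret ext: group_extension W G \<Upsilon> E' \<iota>' \<pi>'
  proof
    show "\<iota>' \<in> hom W E'"
      unfolding \<iota>'_def by (rule hom_compose[OF iota_hom cyc.kappa_hom])
    show "inj_on \<iota>' (carrier W)"
      unfolding \<iota>'_def using cyc.kappa_inj
      by (intro comp_inj_on iota_inj) (auto intro: inj_on_subset)
    show "\<pi>' \<in> hom E' G" by (rule pi')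
    show "kernel E' G \<pi>' = \<iota>' ` carrier W"
    proof
      show "\<iota>' ` carrier W \<subseteq> kernel E' G \<pi>'"
        by (auto simp: kernel_def \<iota>'_def pi')
      show "kernel E' G \<pi>' \<subseteq> \<iota>' ` carrier W"
      proof
        fix p assume "p \<in> kernel E' G \<pi>'"
        then have p: "p \<in> carrier E'" "\<pi>' p = \<one>\<^bsub>G\<^esub>" by (auto simp: kernel_def)
        obtain e a where e: "e \<in> carrier E" "a < q i" "p = \<kappa> e \<otimes>\<^bsub>E'\<^esub> y [^]\<^bsub>E'\<^esub> a"
          using cyc.normal_form[OF p(1)] by blast
        \<comment> \<open>An element of the kernel puts a power of \<open>g i\<close> with exponent
          below \<open>q i\<close> into the subgroup of the earlier generators, so by
          \<open>order\<close> it already lies in the old stage.\<close>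
        have one: "\<pi> e \<otimes>\<^bsub>G\<^esub> g i [^]\<^bsub>G\<^esub> a = \<one>\<^bsub>G\<^esub>"
          using p e pi'_nf by simp
        then have "inv\<^bsub>G\<^esub> (\<pi> e) = g i [^]\<^bsub>G\<^esub> a"
          using e i by (intro G.inv_equality) (simp_all add: G.m_comm)
        then have "g i [^]\<^bsub>G\<^esub> a \<in> generate G (g ` {1..m})"
          using pi_in_generate[of "inv\<^bsub>E\<^esub> e"] e by simp
        then have a: "a = 0" using order e by blast
        then have "e \<in> kernel E G \<pi>" using one e by (simp add: kernel_def)
        then obtain w where "w \<in> carrier W" "e = \<iota> w" using kernel_eq by auto
        then show "p \<in> \<iota>' ` carrier W" using e a by (auto simp: \<iota>'_def)
      qed
    qed
    fix p w assume p: "p \<in> carrier E'" and w: "w \<in> carrier W"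
    obtain e and a :: nat where e: "e \<in> carrier E" "p = \<kappa> e \<otimes>\<^bsub>E'\<^esub> y [^]\<^bsub>E'\<^esub> a"
      using cyc.normal_form[OF p] by blast
    let ?v = "\<Upsilon> (g i [^]\<^bsub>G\<^esub> a) w"
    have v: "?v \<in> carrier W" using w i by simp
    have "p \<otimes>\<^bsub>E'\<^esub> \<iota>' w = \<kappa> e \<otimes>\<^bsub>E'\<^esub> (y [^]\<^bsub>E'\<^esub> a \<otimes>\<^bsub>E'\<^esub> \<kappa> (\<iota> w))"
      using e w by (simp add: \<iota>'_def cyc.E.m_assoc)
    also have "\<dots> = \<kappa> (e \<otimes>\<^bsub>E\<^esub> \<iota> ?v) \<otimes>\<^bsub>E'\<^esub> y [^]\<^bsub>E'\<^esub> a"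
      using e w v i by (simp add: cyc.y_pow_swap tau_pow_iota cyc.E.m_assoc)
    also have "\<dots> = \<iota>' (\<Upsilon> (\<pi> e) ?v) \<otimes>\<^bsub>E'\<^esub> (\<kappa> e \<otimes>\<^bsub>E'\<^esub> y [^]\<^bsub>E'\<^esub> a)"
      using e v by (simp add: iota_swap \<iota>'_def cyc.E.m_assoc)
    finally show "p \<otimes>\<^bsub>E'\<^esub> \<iota>' w = \<iota>' (\<Upsilon> (\<pi>' p) w) \<otimes>\<^bsub>E'\<^esub> p"
      using e w i by (simp add: pi' pi'.hom_nat_pow action_comp)
  qed
  \<comment> \<open>Extend \<open>\<tau> j\<close> to the new stage: \<open>tau_root\<close> gives
    the power relation and \<open>tau_comm\<close> the swap rule.\<close>
  have "\<exists>\<psi>\<in>hom E' E'. (\<forall>e\<in>carrier E. \<psi> (\<kappa> e) = (\<kappa> \<circ> \<tau> j) e) \<and> \<psi> y = \<iota>' (\<beta> i j) \<otimes>\<^bsub>E'\<^esub> y"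
    if j: "j \<in> {1..n}" for j
  proof (rule cyc.extend_hom)
    have bc: "\<beta> i j \<in> carrier W" using i j by simp
    show "group E'" by (rule cyc.E.is_group)
    show "\<kappa> \<circ> \<tau> j \<in> hom E E'" by (rule hom_compose[OF tau_hom[OF j] cyc.kappa_hom])
    show "\<iota>' (\<beta> i j) \<otimes>\<^bsub>E'\<^esub> y \<in> carrier E'" using i j by simp
    show "(\<iota>' (\<beta> i j) \<otimes>\<^bsub>E'\<^esub> y) [^]\<^bsub>E'\<^esub> q i = (\<kappa> \<circ> \<tau> j) c"
    proof -
      have "\<tau> j c = \<iota> (norm_prod W (\<Upsilon> (g i)) (q i) (\<beta> i j)) \<otimes>\<^bsub>E\<^esub> c"
        unfolding c_def by (rule tau_root[OF i j])
      moreover have "(\<iota>' (\<beta> i j) \<otimes>\<^bsub>E'\<^esub> y) [^]\<^bsub>E'\<^esub> q i =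
          \<iota>' (norm_prod W (\<Upsilon> (g i)) (q i) (\<beta> i j)) \<otimes>\<^bsub>E'\<^esub> \<kappa> c"
        by (simp only: ext.pow_iota_mult[OF cyc.y_closed bc] pi' cyc.y_pow)
      ultimately show ?thesis
        using i(2) bc c by (simp add: \<iota>'_def)
    qed
    fix e assume e: "e \<in> carrier E"
    have "\<iota>' (\<beta> i j) \<otimes>\<^bsub>E'\<^esub> y \<otimes>\<^bsub>E'\<^esub> (\<kappa> \<circ> \<tau> j) e = \<kappa> (\<iota> (\<beta> i j)) \<otimes>\<^bsub>E'\<^esub> (y \<otimes>\<^bsub>E'\<^esub> \<kappa> (\<tau> j e))"
      using e j bc by (simp add: \<iota>'_def cyc.E.m_assoc tau_closed)
    also have "\<dots> = \<kappa> (\<iota> (\<beta> i j) \<otimes>\<^bsub>E\<^esub> \<tau> i (\<tau> j e)) \<otimes>\<^bsub>E'\<^esub> y"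
      using e j i(2) bc by (simp add: cyc.y_swap tau_closed cyc.E.m_assoc)
    also have "\<dots> = \<kappa> (\<tau> j (\<tau> i e)) \<otimes>\<^bsub>E'\<^esub> (\<iota>' (\<beta> i j) \<otimes>\<^bsub>E'\<^esub> y)"
      using e j i(2) bc by (simp add: tau_comm tau_closed \<iota>'_def cyc.E.m_assoc)
    finally show "\<iota>' (\<beta> i j) \<otimes>\<^bsub>E'\<^esub> y \<otimes>\<^bsub>E'\<^esub> (\<kappa> \<circ> \<tau> j) e = (\<kappa> \<circ> \<tau> j) (\<tau> i e) \<otimes>\<^bsub>E'\<^esub> (\<iota>' (\<beta> i j) \<otimes>\<^bsub>E'\<^esub> y)"
      by simp
  qed
  then obtain \<tau>' where tau'_hom: "\<And>j. j \<in> {1..n} \<Longrightarrow> \<tau>' j \<in> hom E' E'"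
    and tau'_kappa: "\<And>j e. j \<in> {1..n} \<Longrightarrow> e \<in> carrier E \<Longrightarrow> \<tau>' j (\<kappa> e) = \<kappa> (\<tau> j e)"
    and tau'_y: "\<And>j. j \<in> {1..n} \<Longrightarrow> \<tau>' j y = \<iota>' (\<beta> i j) \<otimes>\<^bsub>E'\<^esub> y"
    by (simp only: o_apply) metis
  have x'_old: "x' k = \<kappa> (x k)" if "k \<in> {1..m}" for k using that i by (simp add: x'_def)
  have x'_new: "x' i = y" by (simp add: x'_def)
  have old: "k \<in> {1..m}" if "k \<in> {1..i}" "k \<noteq> i" for k using that i by auto
  \<comment> \<open>For \<open>k \<le> i\<close> the word stops before \<open>x' i\<close>, so it
    comes from the old stage.\<close>
  have kword: "\<kappa> (word s k) = list_prod E' (map (\<lambda>l. x' l [^]\<^bsub>E'\<^esub> s l) [1..<k])" if "k \<le> i" for s k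
  proof -
    have "\<kappa> (word s k) = list_prod E' (map \<kappa> (map (\<lambda>l. x l [^]\<^bsub>E\<^esub> s l) [1..<k]))"
      unfolding word_def using that i
      by (intro hom_list_prod cyc.kappa_hom E.is_group cyc.E.is_group) (auto intro!: E.nat_pow_closed x_closed)
    also have "map \<kappa> (map (\<lambda>l. x l [^]\<^bsub>E\<^esub> s l) [1..<k]) = map (\<lambda>l. x' l [^]\<^bsub>E'\<^esub> s l) [1..<k]"
      using that i by (auto simp: cyc.kappa.hom_nat_pow x_closed x'_old)
    finally show ?thesis .
  qed
  have "partial_extension W G \<Upsilon> n g q t \<beta> \<gamma> E' \<iota>' \<pi>' i x' \<tau>'"
  proof unfold_locales
    show "x' k \<in> carrier E'" "\<pi>' (x' k) = g k" if "k \<in> {1..i}" for k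
      using that old[of k] by (auto simp: x'_def x_closed pi' pi_x)
    show "i \<le> n" using i by simp
    show "x' l \<otimes>\<^bsub>E'\<^esub> x' k = \<iota>' (\<beta> k l) \<otimes>\<^bsub>E'\<^esub> x' k \<otimes>\<^bsub>E'\<^esub> x' l" if kl: "k \<in> {1..i}" "l \<in> {1..i}" for k l
    proof -
      have y_x: "y \<otimes>\<^bsub>E'\<^esub> \<kappa> (x k) = \<iota>' (\<beta> k i) \<otimes>\<^bsub>E'\<^esub> \<kappa> (x k) \<otimes>\<^bsub>E'\<^esub> y" if "k \<in> {1..m}" for k
        using that i in_n[OF that] x_closed[OF that] by (simp add: cyc.y_swap tau_x \<iota>'_def)
      \<comment> \<open>In turn: \<open>\<beta> i i\<close> is trivial; \<open>y\<close> acts as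
        \<open>\<tau> i\<close>; the previous case is inverted by C1; the old relation is
        transported by \<open>\<kappa>\<close>.\<close>
      consider "k = i" "l = i" | "k \<in> {1..m}" "l = i" | "k = i" "l \<in> {1..m}" | "k \<in> {1..m}" "l \<in> {1..m}"
        using kl old by blast
      then show ?thesis
      proof cases
        case 1
        then show ?thesis by (simp add: x'_new beta_self[OF i(2)])
      next
        case 2
        then show ?thesis using y_x by (simp add: x'_old x'_new)
      next
        case 3
        note cl = i(2) in_n[OF 3(2)] x_closed[OF 3(2)]
        have "\<iota>' (\<beta> i l) \<otimes>\<^bsub>E'\<^esub> y \<otimes>\<^bsub>E'\<^esub> \<kappa> (x l) = \<iota>' (\<beta> i l) \<otimes>\<^bsub>E'\<^esub> (\<iota>' (\<beta> l i) \<otimes>\<^bsub>E'\<^esub> (\<kappa> (x l) \<otimes>\<^bsub>E'\<^esub> y))"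
          using cl y_x[OF 3(2)] by (simp add: cyc.E.m_assoc)
        also have "\<dots> = \<iota>' (\<beta> i l \<otimes>\<^bsub>W\<^esub> \<beta> l i) \<otimes>\<^bsub>E'\<^esub> (\<kappa> (x l) \<otimes>\<^bsub>E'\<^esub> y)"
          using cl by (intro ext.iota_mult_left) auto
        also have "\<dots> = \<kappa> (x l) \<otimes>\<^bsub>E'\<^esub> y"
          using cl by (simp add: beta_swap del: ext.iota.hom_mult)
        finally show ?thesis using 3 by (simp add: x'_old x'_new)
      next
        case 4
        note cl = in_n[OF 4(1)] in_n[OF 4(2)] x_closed[OF 4(1)] x_closed[OF 4(2)]
        have "\<kappa> (x l \<otimes>\<^bsub>E\<^esub> x k) = \<kappa> (\<iota> (\<beta> k l) \<otimes>\<^bsub>E\<^esub> x k \<otimes>\<^bsub>E\<^esub> x l)"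
          by (simp only: x_comm[OF 4])
        then show ?thesis using 4 cl by (simp add: x'_old \<iota>'_def)
      qed
    qed
    show "x' k [^]\<^bsub>E'\<^esub> q k = \<iota>' (\<gamma> k) \<otimes>\<^bsub>E'\<^esub> list_prod E' (map (\<lambda>j. x' j [^]\<^bsub>E'\<^esub> t k j) [1..<k])"
      if k: "k \<in> {1..i}" for k
    proof -
      have kn: "k \<in> {1..n}" "k \<le> i" "word (t k) k \<in> carrier E"
        using k i by (auto intro!: word_closed)
      have "x' k [^]\<^bsub>E'\<^esub> q k = \<kappa> (\<iota> (\<gamma> k) \<otimes>\<^bsub>E\<^esub> word (t k) k)"
      proof (cases "k = i")
        case True
        then show ?thesis by (simp add: x'_new cyc.y_pow c_def)
      next
        case False
        then have km: "k \<in> {1..m}" using old k by blast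
        then have "x' k [^]\<^bsub>E'\<^esub> q k = \<kappa> (x k [^]\<^bsub>E\<^esub> q k)"
          by (simp add: x'_old cyc.kappa.hom_nat_pow x_closed)
        then show ?thesis by (simp only: x_pow[OF km] word_def)
      qed
      then show ?thesis using kn by (simp add: \<iota>'_def kword)
    qed
    show "carrier E' = generate E' (\<iota>' ` carrier W \<union> x' ` {1..i})"
    proof -
      have "insert y (\<kappa> ` (\<iota> ` carrier W \<union> x ` {1..m})) = \<iota>' ` carrier W \<union> x' ` {1..i}"
      proof -
        have "{1..i} = insert i {1..m}" using i by auto
        moreover have "x' ` {1..m} = \<kappa> ` x ` {1..m}"
          using x'_old by (simp add: image_image)
        ultimately show ?thesis by (simp add: x'_new \<iota>'_def image_Un image_comp)
      qed
      then show ?thesis using cyc.carrier_generate[OF generated generators_closed] by argo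
    qed
    show "\<tau>' j \<in> hom E' E'" if "j \<in> {1..n}" for j using tau'_hom that .
    show "\<tau>' j (\<iota>' w) = \<iota>' (\<Upsilon> (g j) w)" if "j \<in> {1..n}" "w \<in> carrier W" for j w
      using that by (simp add: \<iota>'_def tau'_kappa tau_iota)
    show "\<tau>' j (x' k) = \<iota>' (\<beta> k j) \<otimes>\<^bsub>E'\<^esub> x' k" if "j \<in> {1..n}" "k \<in> {1..i}" for j k
    proof (cases "k = i")
      case True
      then show ?thesis using that by (simp add: x'_new tau'_y)
    next
      case False
      then have "k \<in> {1..m}" using old that by blast
      then show ?thesis
        using that in_n[of k] by (simp add: x'_old tau'_kappa x_closed tau_x \<iota>'_def)
    qed
  qed
  then show ?thesis by blast
qed

end

section \<open>The full extension and a section through the lifts\<close>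

context compatible_data
begin

text \<open>The initial stage is \<open>W\<close> itself with trivial projection. The list records
  the exponents of the adjoined lifts and is still empty; it lets all stages share one type.\<close>

lemma partial_extension_0:
  "\<exists>(E :: ('w \<times> nat list) monoid) \<iota> \<pi> x \<tau>. partial_extension W G \<Upsilon> n g q t \<beta> \<gamma> E \<iota> \<pi> 0 x \<tau>"
proof -
  define E :: "('w \<times> nat list) monoid" where "E = \<lparr>carrier = carrier W \<times> {[]},
    monoid.mult = (\<lambda>a b. (fst a \<otimes>\<^bsub>W\<^esub> fst b, [])), one = (\<one>\<^bsub>W\<^esub>, [])\<rparr>"
  define \<iota> :: "'w \<Rightarrow> 'w \<times> nat list" where "\<iota> w = (w, [])" for w
  have "group E"
  proof (rule groupI)
    show "\<exists>b\<in>carrier E. b \<otimes>\<^bsub>E\<^esub> a = \<one>\<^bsub>E\<^esub>" if "a \<in> carrier E" for a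
      using that by (intro bexI[of _ "(inv\<^bsub>W\<^esub> fst a, [])"]) (auto simp: E_def)
  qed (auto simp: E_def W.m_assoc)
  then interpret E: group E .
  have "partial_extension W G \<Upsilon> n g q t \<beta> \<gamma> E \<iota> (\<lambda>_. \<one>\<^bsub>G\<^esub>) 0 x (\<lambda>j a. (\<Upsilon> (g j) (fst a), []))" for x
  proof unfold_locales
    have car: "carrier E = \<iota> ` carrier W" by (auto simp: E_def \<iota>_def)
    have "generate E (carrier E) = carrier E"
      by (intro equalityI E.generate_incl subsetI generate.incl) simp_all
    then show "carrier E = generate E (\<iota> ` carrier W \<union> x ` {1..0})"
      by (simp add: car)
  qed (auto simp: E_def \<iota>_def hom_def kernel_def inj_on_def W.m_comm)
  then show ?thesis by blast
qed

lemma partial_extension_exists: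
  assumes "finite (carrier G)" "m \<le> n"
    and "\<And>i. i \<in> {1..n} \<Longrightarrow> q i = rel_order G g i"
    and rel: "\<And>i. i \<in> {1..n} \<Longrightarrow> g i [^]\<^bsub>G\<^esub> q i = finprod G (\<lambda>j. g j [^]\<^bsub>G\<^esub> t i j) {1..<i}"
  shows "\<exists>(E :: ('w \<times> nat list) monoid) \<iota> \<pi> x \<tau>.
    partial_extension W G \<Upsilon> n g q t \<beta> \<gamma> E \<iota> \<pi> m x \<tau>"
  using assms(2)
proof (induction m)
  case 0
  show ?case by (rule partial_extension_0)
next
  case (Suc m)
  then obtain E :: "('w \<times> nat list) monoid" and \<iota> \<pi> x \<tau>
    where "partial_extension W G \<Upsilon> n g q t \<beta> \<gamma> E \<iota> \<pi> m x \<tau>"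
    by auto
  then interpret partial_extension W G \<Upsilon> n g q t \<beta> \<gamma> E \<iota> \<pi> m x \<tau> .
  have i: "Suc m \<in> {1..n}" using Suc.prems by simp
  have g: "g ` {1..<Suc m} \<subseteq> carrier G" "g (Suc m) \<in> carrier G"
    using Suc.prems by (auto intro!: g_in)
  \<comment> \<open>Each stage prepends its exponent to the list.\<close>
  have "inj (\<lambda>((w :: 'w, as), a :: nat). (w, a # as))"
    by (auto simp: inj_def)
  then show ?case
  proof (rule adjoin[OF _ refl i _ _ rel[OF i]])
    show "0 < q (Suc m)"
      using assms(1,3) i g G.rel_order_pos by simp
    \<comment> \<open>An exponent putting \<open>g (Suc m)\<close> into the subgroup is a multiple
      of \<open>q (Suc m)\<close>, and 0 is the only one below it.\<close>
    show "a = 0" if "a < q (Suc m)" "g (Suc m) [^]\<^bsub>G\<^esub> a \<in> generate G (g ` {1..m})" for a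
    proof -
      have "q (Suc m) dvd a"
        using that(2) assms(3)[OF i] G.rel_order_dvd_iff[OF g, of a]
        by (simp add: atLeastLessThanSuc_atLeastAtMost)
      then show ?thesis using that(1) by (meson dvd_imp_le not_le gr0I)
    qed
  qed
qed

lemma factor_set_exists:
  assumes "finite (carrier G)" "generate G (g ` {1..n}) = carrier G" "inj_on g {1..n}"
    and g_nontriv: "\<And>i. i \<in> {1..n} \<Longrightarrow> g i \<noteq> \<one>\<^bsub>G\<^esub>"
    and "\<And>i. i \<in> {1..n} \<Longrightarrow> q i = rel_order G g i"
    and "\<And>i. i \<in> {1..n} \<Longrightarrow> g i [^]\<^bsub>G\<^esub> q i = finprod G (\<lambda>j. g j [^]\<^bsub>G\<^esub> t i j) {1..<i}"
  shows "\<exists>\<alpha>\<in>factor_sets W G \<Upsilon>. induces_data W G \<Upsilon> n g q t \<beta> \<gamma> \<alpha>"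
proof -
  obtain E :: "('w \<times> nat list) monoid" and \<iota> \<pi> x \<tau>
    where "partial_extension W G \<Upsilon> n g q t \<beta> \<gamma> E \<iota> \<pi> n x \<tau>"
    using partial_extension_exists[OF assms(1) order_refl assms(5,6)] by blast
  then interpret partial_extension W G \<Upsilon> n g q t \<beta> \<gamma> E \<iota> \<pi> n x \<tau> .
  have surj: "\<pi> ` carrier E = carrier G"
  proof
    have "generate G (g ` {1..n}) \<subseteq> \<pi> ` carrier E"
    proof (rule G.generate_subgroup_incl[OF _ pi.img_is_subgroup])
      show "g ` {1..n} \<subseteq> \<pi> ` carrier E"
        using pi_x x_closed by (metis image_eqI image_subsetI)
    qed
    then show "carrier G \<subseteq> \<pi> ` carrier E" using assms(2) by simp
  qed auto
  \<comment> \<open>A normalized section through all the lifts. Taking \<open>x k\<close> at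
    \<open>g k\<close> is unambiguous because the generators are distinct, and compatible with
    \<open>u\<close> being one at one because they are nontrivial; elsewhere any preimage
    serves.\<close>
  define u where "u a = (if a = \<one>\<^bsub>G\<^esub> then \<one>\<^bsub>E\<^esub> else if a \<in> g ` {1..n} then x (inv_into {1..n} g a)
    else inv_into (carrier E) \<pi> a)" for a
  have u: "u a \<in> carrier E \<and> \<pi> (u a) = a" if "a \<in> carrier G" for a
  proof -
    have "inv_into {1..n} g a \<in> {1..n}" "g (inv_into {1..n} g a) = a" if "a \<in> g ` {1..n}"
      using that inv_into_into f_inv_into_f by metis+
    moreover have "inv_into (carrier E) \<pi> a \<in> carrier E" "\<pi> (inv_into (carrier E) \<pi> a) = a"
      using that surj inv_into_into f_inv_into_f by metis+
    ultimately show ?thesis by (simp add: u_def x_closed pi_x)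
  qed
  have ug: "u (g k) = x k" if "k \<in> {1..n}" for k
    using that g_nontriv[OF that] assms(3) by (simp add: u_def)
  have sec: "crossed_section G E \<pi> u"
    using u by (auto simp: crossed_section_def u_def)
  obtain \<alpha> where al: "\<alpha> \<in> factor_sets W G \<Upsilon>" "associated_factor_set G E \<iota> u \<alpha>"
    using factor_set_of_section[of u] u by blast
  have dat: "section_has_data n g q t \<beta> \<gamma> E \<iota> u"
    unfolding section_has_data_def
  proof (intro conjI ballI)
    show "u (g j) \<otimes>\<^bsub>E\<^esub> u (g i) = \<iota> (\<beta> i j) \<otimes>\<^bsub>E\<^esub> u (g i) \<otimes>\<^bsub>E\<^esub> u (g j)"
      if "i \<in> {1..n}" "j \<in> {1..n}" for i j
      using x_comm[OF that] by (simp only: ug[OF that(1)] ug[OF that(2)])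
    show "u (g i) [^]\<^bsub>E\<^esub> q i = \<iota> (\<gamma> i) \<otimes>\<^bsub>E\<^esub> list_prod E (map (\<lambda>j. u (g j) [^]\<^bsub>E\<^esub> t i j) [1..<i])"
      if "i \<in> {1..n}" for i
    proof -
      have "map (\<lambda>j. u (g j) [^]\<^bsub>E\<^esub> t i j) [1..<i] = map (\<lambda>j. x j [^]\<^bsub>E\<^esub> t i j) [1..<i]"
        using that by (auto simp: ug)
      then show ?thesis using x_pow[OF that] by (simp only: ug[OF that])
    qed
  qed
  have "induces_data_via W G \<Upsilon> n g q t \<beta> \<gamma> \<alpha> E \<iota> \<pi> u"
    unfolding induces_data_via_def epi_with_kernel_def induces_action_def epi_def mon_def
    using sec al(2) dat iota_hom iota_inj pi_hom kernel_eq surj E.is_group by (auto simp: conj_iota)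
  \<comment> \<open>The extension just built has elements in \<open>'w \<times> nat list\<close> and
    is moved to the type fixed in \<open>induces_data\<close>.\<close>
  then have "induces_data W G \<Upsilon> n g q t \<beta> \<gamma> \<alpha>"
    using al(1) by (intro induces_data_any_type W.is_group G.is_group) (auto simp: factor_sets_def)
  then show ?thesis using al(1) by blast
qed

end

section \<open>The equivalence\<close>

theorem proposition1:
  fixes W :: "('w, 'm) monoid_scheme" and G :: "('g, 'k) monoid_scheme"
    and \<Upsilon> :: "'g \<Rightarrow> 'w \<Rightarrow> 'w"
    and n :: nat and g :: "nat \<Rightarrow> 'g"
    and q :: "nat \<Rightarrow> nat" and t :: "nat \<Rightarrow> nat \<Rightarrow> nat"
    and \<beta> :: "nat \<Rightarrow> nat \<Rightarrow> 'w" and \<gamma> :: "nat \<Rightarrow> 'w"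
  assumes "comm_group W" and "comm_group G" and "finite (carrier G)"
    and "\<Upsilon> \<in> hom G (AutoGroup W)"
    and "g \<in> {1..n} \<rightarrow> carrier G" and "generate G (g ` {1..n}) = carrier G"
    and generators_distinct: "inj_on g {1..n}"
    and generators_nontrivial: "\<And>i. i \<in> {1..n} \<Longrightarrow> g i \<noteq> \<one>\<^bsub>G\<^esub>"
    and "\<And>i. i \<in> {1..n} \<Longrightarrow> q i = rel_order G g i"
    and "\<And>i. i \<in> {1..n} \<Longrightarrow> g i [^]\<^bsub>G\<^esub> q i = finprod G (\<lambda>j. g j [^]\<^bsub>G\<^esub> t i j) {1..<i}"
    and "\<And>i j. i \<in> {1..n} \<Longrightarrow> j \<in> {1..<i} \<Longrightarrow> t i j < q j"
    and "\<beta> \<in> {1..n} \<rightarrow> {1..n} \<rightarrow> carrier W" and "\<gamma> \<in> {1..n} \<rightarrow> carrier W"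
  shows "(\<exists>\<alpha> \<in> factor_sets W G \<Upsilon>. induces_data W G \<Upsilon> n g q t \<beta> \<gamma> \<alpha>) \<longleftrightarrow>
    (\<forall>i \<in> {1..n}. \<forall>j \<in> {1..n}. \<forall>k \<in> {1..n}.
      (\<beta> i i = \<one>\<^bsub>W\<^esub> \<and> \<beta> i j \<otimes>\<^bsub>W\<^esub> \<beta> j i = \<one>\<^bsub>W\<^esub>) \<and>
      \<beta> i j \<otimes>\<^bsub>W\<^esub> \<beta> j k \<otimes>\<^bsub>W\<^esub> \<beta> k i =
        \<Upsilon> (g k) (\<beta> i j) \<otimes>\<^bsub>W\<^esub> \<Upsilon> (g i) (\<beta> j k) \<otimes>\<^bsub>W\<^esub> \<Upsilon> (g j) (\<beta> k i) \<and>
      norm_prod W (\<Upsilon> (g i)) (q i) (\<beta> i j) \<otimes>\<^bsub>W\<^esub> \<gamma> i =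
        \<Upsilon> (g j) (\<gamma> i) \<otimes>\<^bsub>W\<^esub>
        finprod W
          (\<lambda>m. foldr (\<lambda>l. \<Upsilon> (g l) ^^ t i l) [1..<m]
            (norm_prod W (\<Upsilon> (g m)) (t i m) (\<beta> m j)))
          {1..<i})"
    (is "?factor_set \<longleftrightarrow> ?conditions")
proof -
  interpret presentation_data W G \<Upsilon> n g q t \<beta> \<gamma>
  proof -
    interpret W: comm_group W by fact
    interpret G: comm_group G by fact
    show "presentation_data W G \<Upsilon> n g \<beta> \<gamma>"
      using assms(4,5,12,13) by unfold_locales (auto simp: Pi_iff)
  qed
  have "?factor_set \<longleftrightarrow> compatible_data W G \<Upsilon> n g q t \<beta> \<gamma>"
    using induces_data_conditions[OF presentation_data_axioms]
      compatible_data.factor_set_exists[OF _ assms(3,6,7,8,9,10)] by blast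
  \<comment> \<open>Separate quantifiers for each condition agree with the joint ones, since an
    index \<open>i\<close> in the range supplies values for the missing ones.\<close>
  also have "\<dots> \<longleftrightarrow> ?conditions"
    unfolding compatible_data_def compatible_data_axioms_def twisted_prod_def
    using presentation_data_axioms by auto
  finally show ?thesis .
qed

end
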